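(* Let $\lambda_l^n$ be the eigenvalues of $B_n$, let $\Lambda^I_{k_I}$, $I\in\mathfrak I$, be the Lebesgue constants of the local interpolation operators $\mathcal I^I_{k_I}$ of the adaptive empirical projection method (EPM), and let $e_{\mathrm{int}}=\sum_{I\in\mathfrak I}e^I$ be the integration error (all as defined in the context). Then $$e_{\mathrm{int}}^{1/2}\le\sqrt k\,\Big(1+\Big(\sum_{I\in\mathfrak I}(\Lambda^I_{k_I})^2\Big)^{1/2}\Big)\Big(\sum_{l=k+1}^{d(n)}\lambda_l^n\Big)^{1/2}.$$
   Context: Setting. $\omega=(y_0,y_1)\subset\mathbb R$, $\mathcal D\subset\mathbb R^p$ a parameter domain, $u\in L^2(\mathcal D\times\omega)$, $\mathcal M=\{u(\mu,\cdot):\mu\in\mathcal D\}\subset L^2(\omega)$, and $\Xi\subset\mathcal D$ a finite training set with $|\Xi|=n$. POD. Let $B_n(v)=\frac1n\sum_{\mu\in\Xi}\int_\omega v(z)u(\mu,z)\,dz\;u(\mu,\cdot)$ on $L^2(\omega)$, with eigenvalues $\lambda_1^n\ge\dots\ge\lambda_{d(n)}^n>0$, $\lambda_l^n=0$ for $l>d(n)$, and $L^2(\omega)$-orthonormal eigenfunctions $\kappa_l$. The POD basis is $\kappa_1,\dots,\kappa_k$. Dictionary. $\Sigma$ is a given set of functionals $\sigma(v)=(v,\varsigma)_{L^2(\omega)}$ with $\|\varsigma\|_{L^2(\omega)}=1$. For an interval $I\subset\omega$, $\Sigma^I$ consists of the localized functionals $\sigma^I(v)=(v,\varsigma)_{L^2(I)}$.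 $\Sigma^I$ is unisolvent: if $g\in\mathrm{span}\{\mathcal M\}$ and $\sigma^I(g|_I)=0$ for all $\sigma^I\in\Sigma^I$, then $g=0$ a.e. in $I$. Local generalized empirical interpolation (GEIM). Given linearly independent $\kappa_1^I,\dots,\kappa_{k_I}^I\in L^2(I)$, set $\sigma_1^I=\arg\sup_{\sigma\in\Sigma^I}|\sigma(\kappa_1^I)|$, $q_1^I=\kappa_1^I/\sigma_1^I(\kappa_1^I)$. For $m=2,\dots,k_I$: solve $\sum_{j=1}^{m-1}\alpha_j\sigma_i^I(q_j^I)=\sigma_i^I(\kappa_m^I)$, $1\le i\le m-1$; set $r_m=\kappa_m^I-\sum_{j=1}^{m-1}\alpha_jq_j^I$, $\sigma_m^I=\arg\sup_{\sigma\in\Sigma^I}|\sigma(r_m)|$, and $q_m^I=r_m/\sigma_m^I(r_m)$. Let $\vartheta_j^I$ be the unique functions in $W^I_{k_I}=\mathrm{span}\{\kappa_1^I,\dots,\kappa^I_{k_I}\}$ with $\sigma_i^I(\vartheta_j^I)=\delta_{ij}$. The local interpolant of $v$ is $\mathcal I^I_{k_I}[v](\mu,\cdot)=\sum_{j=1}^{k_I}\sigma_j^I(v(\mu,\cdot))\vartheta_j^I$ on $I$ (extended by zero). Adaptive EPM. $\mathfrak I$ is a partition of $\omega$ into intervals obtained by successive bisection of $\omega$ (in each iteration those $I$ are bisected for which $e^I>\frac{|I|}{|\omega|}\varepsilon_{\mathrm{tol}}^{\mathrm{int}}$, with a given tolerance $\varepsilon_{\mathrm{tol}}^{\mathrm{int}}$,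 until $e_{\mathrm{int}}\le\varepsilon_{\mathrm{tol}}^{\mathrm{int}}$ or a maximal number of iterations is reached). On each $I\in\mathfrak I$ a local GEIM is performed with a linearly independent set $\kappa_1^I,\dots,\kappa_{k_I}^I$ (obtained by a local POD; for $I=\omega$ the set $\kappa_1,\dots,\kappa_k$ itself) with $\mathrm{span}\{\kappa_1^I,\dots,\kappa_{k_I}^I\}=\mathrm{span}\{\kappa_1|_I,\dots,\kappa_k|_I\}$. Set $L=\sum_{I\in\mathfrak I}k_I$, $\mathcal I_L[u](\mu,\cdot)=\sum_{I\in\mathfrak I}\mathcal I^I_{k_I}[u](\mu,\cdot)$, and $$e^I=\frac1n\sum_{\mu\in\Xi}\Big\|\sum_{l=1}^k\int_\omega(u(\mu,z)-\mathcal I_L[u](\mu,z))\kappa_l(z)\,dz\,\kappa_l\Big\|^2_{L^2(I)}.$$ Lebesgue constant with respect to the $L^2(I)$-norm: $$\Lambda^I_{k_I}=\sup_{g(\mu)\in\mathcal M}\frac{\|\mathcal I^I_{k_I}[g](\mu,\cdot)\|_{L^2(I)}}{\|g(\mu,\cdot)\|_{L^2(I)}}.$$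
   Formalization: The Lebesgue constants are taken as suprema over the linear span of the solution manifold instead of over the manifold itself, for which the bound fails in a two-dimensional example; the POD dimension k is taken to be at most d(n). *)

theory Defs
  imports "HOL-Analysis.Analysis"
begin

text \<open>
  Elements of \<open>L\<^sup>2(S)\<close> are represented by functions, with equality almost everywhere.
  All families (eigenpairs, basis functions, functionals) are indexed from 1.
\<close>

definition L2 :: "'a::euclidean_space set \<Rightarrow> ('a \<Rightarrow> real) set" where
  "L2 S = {f. S \<in> sets lebesgue \<and> f \<in> borel_measurable (lebesgue_on S) \<and>
              integrable (lebesgue_on S) (\<lambda>x. (f x)\<^sup>2)}"

definition l2_inner :: "'a::euclidean_space set \<Rightarrow> ('a \<Rightarrow> real) \<Rightarrow> ('a \<Rightarrow> real) \<Rightarrow> real" where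
  "l2_inner S f g = (LINT x|lebesgue_on S. f x * g x)"

definition l2_norm :: "'a::euclidean_space set \<Rightarrow> ('a \<Rightarrow> real) \<Rightarrow> real" where
  "l2_norm S f = sqrt (l2_inner S f f)"

text \<open>The linear span of (the restrictions to \<open>S\<close> of) \<open>V\<close> as a subspace of \<open>L\<^sup>2(S)\<close>.\<close>

definition L2_span :: "real set \<Rightarrow> (real \<Rightarrow> real) set \<Rightarrow> (real \<Rightarrow> real) set" where
  "L2_span S V = {g \<in> L2 S. \<exists>F a. finite F \<and> F \<subseteq> V \<and>
                    (AE x in lebesgue_on S. g x = (\<Sum>f\<in>F. a f * f x))}"

definition L2_independent :: "real set \<Rightarrow> nat \<Rightarrow> (nat \<Rightarrow> real \<Rightarrow> real) \<Rightarrow> bool" where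
  "L2_independent S N f \<longleftrightarrow>
     (\<forall>a. (AE x in lebesgue_on S. (\<Sum>l=1..N. a l * f l x) = 0) \<longrightarrow> (\<forall>l\<in>{1..N}. a l = 0))"


subsection \<open>Proper orthogonal decomposition\<close>

definition pod_op ::
  "real set \<Rightarrow> 'm set \<Rightarrow> ('m \<Rightarrow> real \<Rightarrow> real) \<Rightarrow> (real \<Rightarrow> real) \<Rightarrow> real \<Rightarrow> real" where
  "pod_op \<omega> \<Xi> u v = (\<lambda>y. 1 / real (card \<Xi>) * (\<Sum>\<mu>\<in>\<Xi>. l2_inner \<omega> v (u \<mu>) * u \<mu> y))"

text \<open>
  The last conjunct says that \<open>ev 1, \<dots>, ev d\<close> is the complete list of nonzero eigenvalues,
  repeated according to multiplicity: the eigenspace of every \<open>c \<noteq> 0\<close> is spanned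
  by the listed eigenfunctions belonging to \<open>c\<close> (and hence is trivial if \<open>c\<close> is not listed).
\<close>

definition is_pod ::
  "real set \<Rightarrow> 'm set \<Rightarrow> ('m \<Rightarrow> real \<Rightarrow> real) \<Rightarrow> nat \<Rightarrow> (nat \<Rightarrow> real) \<Rightarrow> (nat \<Rightarrow> real \<Rightarrow> real) \<Rightarrow> bool"
  where
  "is_pod \<omega> \<Xi> u d ev \<kappa> \<longleftrightarrow>
     (\<forall>l\<in>{1..d}. ev l > 0) \<and> (\<forall>l>d. ev l = 0) \<and>
     (\<forall>i j. 1 \<le> i \<and> i \<le> j \<and> j \<le> d \<longrightarrow> ev j \<le> ev i) \<and>
     (\<forall>l\<in>{1..d}. \<kappa> l \<in> L2 \<omega> \<and>
        (AE y in lebesgue_on \<omega>. pod_op \<omega> \<Xi> u (\<kappa> l) y = ev l * \<kappa> l y)) \<and>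
     (\<forall>i\<in>{1..d}. \<forall>j\<in>{1..d}. l2_inner \<omega> (\<kappa> i) (\<kappa> j) = (if i = j then 1 else 0)) \<and>
     (\<forall>c v. c \<noteq> 0 \<and> v \<in> L2 \<omega> \<and> (AE y in lebesgue_on \<omega>. pod_op \<omega> \<Xi> u v y = c * v y) \<longrightarrow>
        v \<in> L2_span \<omega> (\<kappa> ` {l \<in> {1..d}. ev l = c}))"


subsection \<open>Dictionary and local generalized empirical interpolation\<close>

text \<open>A dictionary is given by the set of Riesz representers of its functionals.\<close>

definition is_dictionary :: "real set \<Rightarrow> (real \<Rightarrow> real) set \<Rightarrow> bool" where
  "is_dictionary \<omega> R \<longleftrightarrow> (\<forall>\<rho>\<in>R. \<rho> \<in> L2 \<omega> \<and> l2_norm \<omega> \<rho> = 1)"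

definition local_dictionary ::
  "(real \<Rightarrow> real) set \<Rightarrow> real set \<Rightarrow> ((real \<Rightarrow> real) \<Rightarrow> real) set" where
  "local_dictionary R I = (\<lambda>\<rho> v. l2_inner I v \<rho>) ` R"

definition unisolvent ::
  "real set \<Rightarrow> (real \<Rightarrow> real) set \<Rightarrow> real set \<Rightarrow> ((real \<Rightarrow> real) \<Rightarrow> real) set \<Rightarrow> bool" where
  "unisolvent \<omega> M I S \<longleftrightarrow>
     (\<forall>g\<in>L2_span \<omega> M. (\<forall>\<tau>\<in>S. \<tau> g = 0) \<longrightarrow> (AE x in lebesgue_on I. g x = 0))"

text \<open>
  \<open>is_geim S I N b \<sigma> q \<theta>\<close>: the greedy procedure with dictionary \<open>S\<close> applied to
  \<open>b 1, \<dots>, b N\<close> may select the functionals \<open>\<sigma>\<close> and produce the functions \<open>q\<close>,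
  and \<open>\<theta>\<close> is the nodal basis. For \<open>m = 1\<close> the linear system is empty and \<open>r = b 1\<close>.
\<close>

definition is_geim ::
  "((real \<Rightarrow> real) \<Rightarrow> real) set \<Rightarrow> real set \<Rightarrow> nat \<Rightarrow> (nat \<Rightarrow> real \<Rightarrow> real) \<Rightarrow>
   (nat \<Rightarrow> (real \<Rightarrow> real) \<Rightarrow> real) \<Rightarrow> (nat \<Rightarrow> real \<Rightarrow> real) \<Rightarrow> (nat \<Rightarrow> real \<Rightarrow> real) \<Rightarrow> bool" where
  "is_geim S I N b \<sigma> q \<theta> \<longleftrightarrow>
     (\<forall>m\<in>{1..N}. \<exists>\<alpha> r.
        (\<forall>i\<in>{1..<m}. (\<Sum>j=1..<m. \<alpha> j * \<sigma> i (q j)) = \<sigma> i (b m)) \<and>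
        r = (\<lambda>x. b m x - (\<Sum>j=1..<m. \<alpha> j * q j x)) \<and>
        \<sigma> m \<in> S \<and> (\<forall>\<tau>\<in>S. \<bar>\<tau> r\<bar> \<le> \<bar>\<sigma> m r\<bar>) \<and>
        q m = (\<lambda>x. r x / \<sigma> m r)) \<and>
     (\<forall>j\<in>{1..N}. \<theta> j \<in> L2_span I (b ` {1..N}) \<and>
        (\<forall>i\<in>{1..N}. \<sigma> i (\<theta> j) = (if i = j then 1 else 0)))"

definition local_interp ::
  "real set \<Rightarrow> nat \<Rightarrow> (nat \<Rightarrow> (real \<Rightarrow> real) \<Rightarrow> real) \<Rightarrow> (nat \<Rightarrow> real \<Rightarrow> real) \<Rightarrow>
   (real \<Rightarrow> real) \<Rightarrow> real \<Rightarrow> real" where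
  "local_interp I N \<sigma> \<theta> v = (\<lambda>y. indicator I y * (\<Sum>j=1..N. \<sigma> j v * \<theta> j y))"

text \<open>
  The supremum is over the linear span of the solution manifold \<open>M\<close>, the space on which
  unisolvence is required. Restricting it to \<open>M\<close> itself would not control the operator \<open>J\<close>
  on differences such as \<open>u(\<mu>,\<cdot>)\<close> minus its projection onto the POD space.
  If \<open>g\<close> vanishes a.e. on \<open>I\<close>, then so does its interpolant, and the quotient \<open>0 / 0 = 0\<close>
  does not affect the supremum. For a GEIM operator the quotients are bounded
  (by the sum of the norms of the nodal basis functions), so the real supremum is the true one.
\<close>

definition lebesgue_const ::
  "real set \<Rightarrow> (real \<Rightarrow> real) set \<Rightarrow> real set \<Rightarrow> ((real \<Rightarrow> real) \<Rightarrow> real \<Rightarrow> real) \<Rightarrow> real" where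
  "lebesgue_const \<omega> M I J = (SUP g\<in>L2_span \<omega> M. l2_norm I (J g) / l2_norm I g)"


subsection \<open>Adaptive empirical projection\<close>

definition epm_interp ::
  "real set set \<Rightarrow> (real set \<Rightarrow> nat) \<Rightarrow> (real set \<Rightarrow> nat \<Rightarrow> (real \<Rightarrow> real) \<Rightarrow> real) \<Rightarrow>
   (real set \<Rightarrow> nat \<Rightarrow> real \<Rightarrow> real) \<Rightarrow> (real \<Rightarrow> real) \<Rightarrow> real \<Rightarrow> real" where
  "epm_interp P N \<sigma> \<theta> v = (\<lambda>y. \<Sum>I\<in>P. local_interp I (N I) (\<sigma> I) (\<theta> I) v y)"

definition local_err ::
  "real set \<Rightarrow> 'm set \<Rightarrow> ('m \<Rightarrow> real \<Rightarrow> real) \<Rightarrow> nat \<Rightarrow> (nat \<Rightarrow> real \<Rightarrow> real) \<Rightarrow>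
   ((real \<Rightarrow> real) \<Rightarrow> real \<Rightarrow> real) \<Rightarrow> real set \<Rightarrow> real" where
  "local_err \<omega> \<Xi> u k \<kappa> J I =
     1 / real (card \<Xi>) *
       (\<Sum>\<mu>\<in>\<Xi>. (l2_norm I (\<lambda>y. \<Sum>l=1..k. l2_inner \<omega> (\<lambda>z. u \<mu> z - J (u \<mu>) z) (\<kappa> l) * \<kappa> l y))\<^sup>2)"

definition bisect :: "real set \<Rightarrow> real set set" where
  "bisect I = (let m = (Inf I + Sup I) / 2 in {I \<inter> {..m}, I \<inter> {m<..}})"

text \<open>
  \<open>P 0, \<dots>, P T\<close> is a complete run of the adaptive bisection with tolerance \<open>tol\<close> and at most
  \<open>Tmax\<close> iterations, where \<open>e Q I\<close> is the error indicator of \<open>I\<close> for the partition \<open>Q\<close>.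
\<close>

definition adaptive_run ::
  "real set \<Rightarrow> (real set set \<Rightarrow> real set \<Rightarrow> real) \<Rightarrow> real \<Rightarrow> nat \<Rightarrow> (nat \<Rightarrow> real set set) \<Rightarrow> nat \<Rightarrow> bool"
  where
  "adaptive_run \<omega> e tol Tmax P T \<longleftrightarrow>
     P 0 = {\<omega>} \<and> T \<le> Tmax \<and>
     (\<forall>t<T. (\<Sum>I\<in>P t. e (P t) I) > tol \<and>
        (let marked = {I \<in> P t. e (P t) I > measure lebesgue I / measure lebesgue \<omega> * tol}
         in P (Suc t) = (P t - marked) \<union> \<Union> (bisect ` marked))) \<and>
     ((\<Sum>I\<in>P T. e (P T) I) \<le> tol \<or> T = Tmax)"

end

theory Submission
  imports Defs "Jordan_Normal_Form.Determinant"
begin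

text \<open>
  Let \<open>\<Pi>\<close> be the orthogonal projection onto the first \<open>k\<close> modes, \<open>J\<close> the interpolation operator of the
  final partition, and \<open>w = u - \<Pi> u\<close> for a snapshot \<open>u\<close>. On every cell the nodal functions form a basis of
  the restricted POD space, so \<open>J\<close> reproduces this space (\<open>nodal_interpolation_exact\<close>) and
  \<open>u - J u = w - J w\<close>. The integration error measures \<open>\<Pi> (u - J u)\<close>, and \<open>\<Pi> w = 0\<close>, so it measures
  \<open>- \<Pi> (J w)\<close>. By Bessel's inequality its squared norm is at most the sum over the cells \<open>I\<close> of the
  squared norms of \<open>J w\<close> on \<open>I\<close>, each of which is at most the squared Lebesgue constant of \<open>I\<close> times the
  squared norm of \<open>w\<close> (\<open>projected_interpolation_error_le\<close>). The definition of the Lebesgue constant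
  applies to \<open>w\<close> because the modes, being eigenfunctions with positive eigenvalues, are combinations of
  snapshots, so that \<open>w\<close> lies in the span of the solution manifold.

  The mean over the training set of the squared norm of \<open>w\<close> is the sum of the discarded eigenvalues
  (\<open>pod_truncation_error\<close>). This rests on the fact that the modes span all snapshots (\<open>pod_complete\<close>):
  otherwise the Gram matrix of the remainders would have a positive eigenvalue, and with it the POD
  operator an eigenfunction outside the span of the listed ones.

  Together, the integration error is at most the sum of the squared Lebesgue constants times the sum of
  the discarded eigenvalues. The factor \<open>\<surd>k (1 + \<dots>)\<close> of the theorem only enlarges the square root of this
  bound when \<open>k \<ge> 1\<close>; for \<open>k = 0\<close> the integration error is zero.
\<close>

section \<open>Inner product and norm on square-integrable functions\<close>

lemma L2_sets: "f \<in> L2 S \<Longrightarrow> S \<in> sets lebesgue"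
  by (simp add: L2_def)

lemma L2_measurable: "f \<in> L2 S \<Longrightarrow> f \<in> borel_measurable (lebesgue_on S)"
  by (simp add: L2_def)

lemma L2_mult_integrable:
  assumes "f \<in> L2 S" "g \<in> L2 S"
  shows "integrable (lebesgue_on S) (\<lambda>x. f x * g x)"
proof (rule Bochner_Integration.integrable_bound)
  show "integrable (lebesgue_on S) (\<lambda>x. (f x)\<^sup>2 + (g x)\<^sup>2)"
    using assms by (simp add: L2_def)
  show "(\<lambda>x. f x * g x) \<in> borel_measurable (lebesgue_on S)"
    using assms by (rule borel_measurable_times[OF L2_measurable L2_measurable])
  have "\<bar>a * b\<bar> \<le> a\<^sup>2 + b\<^sup>2" for a b :: real
    using sum_squares_bound[of "\<bar>a\<bar>" "\<bar>b\<bar>"] mult_nonneg_nonneg[of "\<bar>a\<bar>" "\<bar>b\<bar>"]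
    unfolding abs_mult power2_abs by linarith
  then show "AE x in lebesgue_on S. norm (f x * g x) \<le> norm ((f x)\<^sup>2 + (g x)\<^sup>2)"
    by (intro AE_I2) simp
qed

lemma L2_zero: "S \<in> sets lebesgue \<Longrightarrow> (\<lambda>x. 0) \<in> L2 S"
  by (simp add: L2_def)

lemma L2_add:
  assumes "f \<in> L2 S" "g \<in> L2 S"
  shows "(\<lambda>x. f x + g x) \<in> L2 S"
proof -
  have "integrable (lebesgue_on S) (\<lambda>x. (f x)\<^sup>2 + (g x)\<^sup>2 + 2 * (f x * g x))"
    using assms L2_mult_integrable[OF assms]
    by (intro Bochner_Integration.integrable_add integrable_mult_right) (auto simp: L2_def)
  also have "(\<lambda>x. (f x)\<^sup>2 + (g x)\<^sup>2 + 2 * (f x * g x)) = (\<lambda>x. (f x + g x)\<^sup>2)"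
    by (simp add: power2_sum mult.assoc)
  finally show ?thesis
    using assms by (auto simp: L2_def)
qed

lemma L2_cmult: "f \<in> L2 S \<Longrightarrow> (\<lambda>x. c * f x) \<in> L2 S"
  by (auto simp: L2_def power_mult_distrib)

lemma L2_diff: "f \<in> L2 S \<Longrightarrow> g \<in> L2 S \<Longrightarrow> (\<lambda>x. f x - g x) \<in> L2 S"
  using L2_add[OF _ L2_cmult[of g S "-1"], of f] by simp

lemma L2_sum:
  assumes "S \<in> sets lebesgue" "\<And>i. i \<in> A \<Longrightarrow> f i \<in> L2 S"
  shows "(\<lambda>x. \<Sum>i\<in>A. f i x) \<in> L2 S"
  using assms(2)
  by (induction A rule: infinite_finite_induct) (auto simp: L2_zero assms(1) L2_add)

lemma L2_combination:
  assumes "S \<in> sets lebesgue" "\<And>i. i \<in> A \<Longrightarrow> f i \<in> L2 S"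
  shows "(\<lambda>x. \<Sum>i\<in>A. c i * f i x) \<in> L2 S"
  using assms by (intro L2_sum L2_cmult)

lemma l2_inner_commute: "l2_inner S f g = l2_inner S g f"
  by (simp add: l2_inner_def mult.commute)

lemma l2_inner_cmult_left: "l2_inner S (\<lambda>x. c * f x) g = c * l2_inner S f g"
  by (simp add: l2_inner_def mult.assoc)

lemma l2_inner_cmult_right: "l2_inner S g (\<lambda>x. c * f x) = c * l2_inner S g f"
  by (simp add: l2_inner_def mult.left_commute)

lemma l2_inner_add_left:
  assumes "f \<in> L2 S" "g \<in> L2 S" "h \<in> L2 S"
  shows "l2_inner S (\<lambda>x. f x + g x) h = l2_inner S f h + l2_inner S g h"
  using assms by (simp add: l2_inner_def distrib_right L2_mult_integrable)

lemma l2_inner_add_right: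
  assumes "f \<in> L2 S" "g \<in> L2 S" "h \<in> L2 S"
  shows "l2_inner S h (\<lambda>x. f x + g x) = l2_inner S h f + l2_inner S h g"
  using l2_inner_add_left[OF assms] by (simp add: l2_inner_commute)

lemma l2_inner_diff_left:
  assumes "f \<in> L2 S" "g \<in> L2 S" "h \<in> L2 S"
  shows "l2_inner S (\<lambda>x. f x - g x) h = l2_inner S f h - l2_inner S g h"
  using assms by (simp add: l2_inner_def left_diff_distrib L2_mult_integrable)

lemma l2_inner_diff_right:
  assumes "f \<in> L2 S" "g \<in> L2 S" "h \<in> L2 S"
  shows "l2_inner S h (\<lambda>x. f x - g x) = l2_inner S h f - l2_inner S h g"
  using l2_inner_diff_left[OF assms] by (simp add: l2_inner_commute)

lemma l2_inner_combination_left: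
  assumes "\<And>i. i \<in> A \<Longrightarrow> f i \<in> L2 S" "h \<in> L2 S"
  shows "l2_inner S (\<lambda>x. \<Sum>i\<in>A. c i * f i x) h = (\<Sum>i\<in>A. c i * l2_inner S (f i) h)"
  using assms by (simp add: l2_inner_def sum_distrib_right mult.assoc L2_mult_integrable)

lemma l2_inner_combination_right:
  assumes "\<And>i. i \<in> A \<Longrightarrow> f i \<in> L2 S" "h \<in> L2 S"
  shows "l2_inner S h (\<lambda>x. \<Sum>i\<in>A. c i * f i x) = (\<Sum>i\<in>A. c i * l2_inner S h (f i))"
  using l2_inner_combination_left[OF assms] by (simp add: l2_inner_commute)

lemma l2_inner_cong_AE:
  assumes "f \<in> L2 S" "f' \<in> L2 S" "g \<in> L2 S" "AE x in lebesgue_on S. f x = f' x"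
  shows "l2_inner S f g = l2_inner S f' g"
  unfolding l2_inner_def
proof (rule integral_cong_AE)
  show "(\<lambda>x. f x * g x) \<in> borel_measurable (lebesgue_on S)"
    "(\<lambda>x. f' x * g x) \<in> borel_measurable (lebesgue_on S)"
    using assms(1-3) by (auto intro: borel_measurable_times[OF L2_measurable L2_measurable])
  show "AE x in lebesgue_on S. f x * g x = f' x * g x"
    using assms(4) by eventually_elim simp
qed

lemma l2_inner_cong:
  assumes "S \<in> sets lebesgue" "\<And>x. x \<in> S \<Longrightarrow> f x = f' x" "\<And>x. x \<in> S \<Longrightarrow> g x = g' x"
  shows "l2_inner S f g = l2_inner S f' g'"
  unfolding l2_inner_def using assms by (intro Bochner_Integration.integral_cong) auto

lemma l2_inner_self_nonneg: "0 \<le> l2_inner S f f"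
  by (simp add: l2_inner_def)

lemma l2_norm_nonneg: "0 \<le> l2_norm S f"
  by (simp add: l2_norm_def l2_inner_self_nonneg)

lemma l2_norm_power2: "(l2_norm S f)\<^sup>2 = l2_inner S f f"
  by (simp add: l2_norm_def l2_inner_self_nonneg)

lemma l2_inner_self_eq_0D:
  assumes "f \<in> L2 S" "l2_inner S f f = 0"
  shows "AE x in lebesgue_on S. f x = 0"
  using assms integral_nonneg_eq_0_iff_AE[OF L2_mult_integrable[OF assms(1) assms(1)]]
  by (simp add: l2_inner_def)

lemma l2_Cauchy_Schwarz:
  assumes f: "f \<in> L2 S" and g: "g \<in> L2 S"
  shows "\<bar>l2_inner S f g\<bar> \<le> l2_norm S f * l2_norm S g"
proof -
  let ?a = "l2_inner S f f" and ?b = "l2_inner S f g" and ?c = "l2_inner S g g"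
  have "?b\<^sup>2 \<le> ?a * ?c"
  proof (cases "?c = 0")
    case True
    then have "AE x in lebesgue_on S. g x = 0"
      by (rule l2_inner_self_eq_0D[OF g])
    then have "l2_inner S g f = l2_inner S (\<lambda>x. 0) f"
      using f g by (intro l2_inner_cong_AE) (auto intro: L2_zero L2_sets)
    then show ?thesis
      using True by (simp add: l2_inner_commute[of S f g]) (simp add: l2_inner_def)
  next
    case False
    let ?h = "\<lambda>x. ?c * f x - ?b * g x"
    have h: "?h \<in> L2 S" using f g by (intro L2_diff L2_cmult)
    have hf: "l2_inner S ?h f = ?c * ?a - ?b * ?b"
      using f g by (simp add: l2_inner_diff_left L2_cmult l2_inner_cmult_left l2_inner_commute[of S g f])
    have hg: "l2_inner S ?h g = 0"
      using f g by (simp add: l2_inner_diff_left L2_cmult l2_inner_cmult_left)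
    have "l2_inner S ?h ?h = ?c * l2_inner S f ?h - ?b * l2_inner S g ?h"
      using f g h by (subst l2_inner_diff_left) (auto simp: L2_cmult l2_inner_cmult_left)
    also have "\<dots> = ?c * (?c * ?a - ?b\<^sup>2)"
      using hf hg l2_inner_commute[of S f ?h] l2_inner_commute[of S g ?h]
      by (simp add: power2_eq_square)
    finally have "0 \<le> ?c * (?c * ?a - ?b\<^sup>2)"
      using l2_inner_self_nonneg[of S ?h] by simp
    then show ?thesis
      using False l2_inner_self_nonneg[of S g] by (simp add: zero_le_mult_iff mult.commute)
  qed
  then have "sqrt (?b\<^sup>2) \<le> sqrt (?a * ?c)" by (simp only: real_sqrt_le_iff)
  then show ?thesis by (simp add: l2_norm_def real_sqrt_mult)
qed

lemma l2_norm_add: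
  assumes f: "f \<in> L2 S" and g: "g \<in> L2 S"
  shows "l2_norm S (\<lambda>x. f x + g x) \<le> l2_norm S f + l2_norm S g"
proof (rule power2_le_imp_le)
  have "(l2_norm S (\<lambda>x. f x + g x))\<^sup>2
      = l2_inner S f (\<lambda>x. f x + g x) + l2_inner S g (\<lambda>x. f x + g x)"
    using f g by (simp add: l2_norm_power2 l2_inner_add_left L2_add)
  also have "\<dots> = (l2_norm S f)\<^sup>2 + 2 * l2_inner S f g + (l2_norm S g)\<^sup>2"
    using f g by (simp add: l2_inner_add_right l2_norm_power2 l2_inner_commute[of S g f])
  also have "\<dots> \<le> (l2_norm S f + l2_norm S g)\<^sup>2"
    using l2_Cauchy_Schwarz[OF f g] by (simp add: power2_sum)
  finally show "(l2_norm S (\<lambda>x. f x + g x))\<^sup>2 \<le> (l2_norm S f + l2_norm S g)\<^sup>2" .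
qed (simp add: l2_norm_nonneg)

lemma l2_norm_cmult: "l2_norm S (\<lambda>x. c * f x) = \<bar>c\<bar> * l2_norm S f"
proof -
  have "l2_inner S (\<lambda>x. c * f x) (\<lambda>x. c * f x) = c\<^sup>2 * l2_inner S f f"
    by (simp add: l2_inner_cmult_left l2_inner_cmult_right power2_eq_square)
  then show ?thesis by (simp add: l2_norm_def real_sqrt_mult)
qed

text \<open>
  Applied to an interpolant, whose coefficients are values of bounded functionals, this shows that
  the quotients in the Lebesgue constant are bounded.
\<close>
lemma l2_norm_combination:
  assumes "S \<in> sets lebesgue" "\<And>i. i \<in> A \<Longrightarrow> f i \<in> L2 S"
  shows "l2_norm S (\<lambda>x. \<Sum>i\<in>A. c i * f i x) \<le> (\<Sum>i\<in>A. \<bar>c i\<bar> * l2_norm S (f i))"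
  using assms(2)
proof (induction A rule: infinite_finite_induct)
  case (insert i A)
  have "l2_norm S (\<lambda>x. c i * f i x + (\<Sum>i\<in>A. c i * f i x))
      \<le> l2_norm S (\<lambda>x. c i * f i x) + l2_norm S (\<lambda>x. \<Sum>i\<in>A. c i * f i x)"
    using insert.prems assms(1) by (intro l2_norm_add L2_cmult L2_combination) auto
  also have "\<dots> \<le> \<bar>c i\<bar> * l2_norm S (f i) + (\<Sum>i\<in>A. \<bar>c i\<bar> * l2_norm S (f i))"
    using insert by (simp add: l2_norm_cmult)
  finally show ?case using insert by simp
qed (simp_all add: l2_norm_def l2_inner_def)

lemma L2_mono:
  assumes "f \<in> L2 S" "I \<subseteq> S" "I \<in> sets lebesgue"
  shows "f \<in> L2 I"
proof -
  have S: "S \<in> sets lebesgue" using assms by (simp add: L2_def)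
  have "f \<in> borel_measurable (lebesgue_on I)"
    using assms S L2_measurable[OF assms(1)] by (metis measurable_restrict_mono)
  moreover have "integrable (lebesgue_on I) (\<lambda>x. (f x)\<^sup>2)"
  proof -
    have "integrable lebesgue (\<lambda>x. indicator S x * (f x)\<^sup>2)"
      using assms(1) S by (simp add: L2_def integrable_restrict_space)
    then have "integrable lebesgue (\<lambda>x. indicator S x * (f x)\<^sup>2 * indicator I x)"
      by (rule integrable_real_mult_indicator[OF assms(3)])
    moreover have "indicator S x * (f x)\<^sup>2 * indicator I x = indicator I x * (f x)\<^sup>2" for x
      using assms(2) by (auto split: split_indicator)
    ultimately show ?thesis
      using assms(3) by (simp add: integrable_restrict_space)
  qed
  ultimately show ?thesis using assms by (simp add: L2_def)
qed

lemma L2_extend_by_zero: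
  assumes "f \<in> L2 I" "I \<subseteq> S" "S \<in> sets lebesgue"
  shows "(\<lambda>x. indicator I x * f x) \<in> L2 S"
proof -
  have I: "I \<in> sets lebesgue" using assms by (simp add: L2_def)
  have meas: "(\<lambda>x. indicator I x * f x) \<in> borel_measurable lebesgue"
    using L2_measurable[OF assms(1)] I
    by (simp add: borel_measurable_restrict_space_iff)
  have "integrable lebesgue (\<lambda>x. indicator I x * (f x)\<^sup>2)"
    using assms(1) I by (simp add: L2_def integrable_restrict_space)
  moreover have ind: "indicator S x * (indicator I x * f x)\<^sup>2 = indicator I x * (f x)\<^sup>2" for x
    using assms(2) by (auto split: split_indicator)
  ultimately have int: "integrable lebesgue (\<lambda>x. indicator S x * (indicator I x * f x)\<^sup>2)"
    using ind by simp
  then have "integrable (lebesgue_on S) (\<lambda>x. (indicator I x * f x)\<^sup>2)"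
    using assms(3) by (simp add: integrable_restrict_space)
  then show ?thesis
    using meas assms(3) by (simp add: L2_def measurable_restrict_space1)
qed

text \<open>
  Cells are disjoint and cover \<open>S\<close> exactly, so the indicators of the cells add up to the indicator
  of \<open>S\<close>. This is what turns norms on \<open>S\<close> into sums of the cellwise norms in the error indicators.
\<close>
lemma l2_inner_partition:
  assumes "f \<in> L2 S" "g \<in> L2 S" "finite P" "disjoint P" "\<Union>P = S" "P \<subseteq> sets lebesgue"
  shows "l2_inner S f g = (\<Sum>I\<in>P. l2_inner I f g)"
proof -
  have S: "S \<in> sets lebesgue" using assms by (simp add: L2_def)
  have int: "integrable lebesgue (\<lambda>x. indicator I x *\<^sub>R (f x * g x))" if "I \<in> P" for I
  proof -
    have I: "I \<subseteq> S" "I \<in> sets lebesgue" using that assms(5,6) by auto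
    have "integrable (lebesgue_on I) (\<lambda>x. f x * g x)"
      by (intro L2_mult_integrable L2_mono[OF _ I] assms(1,2))
    then show ?thesis using I(2) by (simp add: integrable_restrict_space)
  qed
  have ind: "indicator S x = (\<Sum>I\<in>P. indicator I x :: real)" for x
    using assms(3,4) indicator_UN_disjoint[of P "\<lambda>I. I" x]
    unfolding assms(5)[symmetric] by (simp add: disjoint_family_on_def disjoint_def)
  have "l2_inner S f g = (LINT x|lebesgue. indicator S x *\<^sub>R (f x * g x))"
    using S by (simp add: l2_inner_def integral_restrict_space)
  also have "\<dots> = (LINT x|lebesgue. (\<Sum>I\<in>P. indicator I x *\<^sub>R (f x * g x)))"
    by (simp only: ind scaleR_left.sum)
  also have "\<dots> = (\<Sum>I\<in>P. LINT x|lebesgue. indicator I x *\<^sub>R (f x * g x))"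
    using int by (intro Bochner_Integration.integral_sum)
  also have "\<dots> = (\<Sum>I\<in>P. l2_inner I f g)"
    using assms(6) by (intro sum.cong) (auto simp: l2_inner_def integral_restrict_space)
  finally show ?thesis .
qed

lemma l2_inner_self_mono:
  assumes "f \<in> L2 S" "I \<subseteq> S" "I \<in> sets lebesgue"
  shows "l2_inner I f f \<le> l2_inner S f f"
proof -
  have "l2_inner S f f = (\<Sum>A\<in>{I, S - I}. l2_inner A f f)"
    using assms by (intro l2_inner_partition) (auto simp: disjoint_def L2_def)
  also have "\<dots> \<ge> l2_inner I f f"
    by (intro member_le_sum) (auto simp: l2_inner_self_nonneg)
  finally show ?thesis .
qed

section \<open>Spans in \<open>L\<^sup>2\<close>\<close>

lemma L2_span_L2: "g \<in> L2_span S V \<Longrightarrow> g \<in> L2 S"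
  by (simp add: L2_span_def)

lemma L2_span_base:
  assumes "f \<in> V" "f \<in> L2 S"
  shows "f \<in> L2_span S V"
  unfolding L2_span_def using assms
  by (auto intro!: exI[of _ "{f}"] exI[of _ "\<lambda>_. 1"])

lemma L2_span_cong_AE:
  assumes "f \<in> L2_span S V" "g \<in> L2 S" "AE x in lebesgue_on S. g x = f x"
  shows "g \<in> L2_span S V"
proof -
  obtain F a where F: "finite F" "F \<subseteq> V" "AE x in lebesgue_on S. f x = (\<Sum>h\<in>F. a h * h x)"
    using assms(1) by (auto simp: L2_span_def)
  have "AE x in lebesgue_on S. g x = (\<Sum>h\<in>F. a h * h x)"
    using assms(3) F(3) by eventually_elim simp
  then show ?thesis using F(1,2) assms(2) by (auto simp: L2_span_def)
qed

lemma L2_span_cmult: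
  assumes "f \<in> L2_span S V"
  shows "(\<lambda>x. c * f x) \<in> L2_span S V"
proof -
  obtain F a where F: "finite F" "F \<subseteq> V" "AE x in lebesgue_on S. f x = (\<Sum>h\<in>F. a h * h x)"
    using assms(1) by (auto simp: L2_span_def)
  have "AE x in lebesgue_on S. c * f x = (\<Sum>h\<in>F. (c * a h) * h x)"
    using F(3) by eventually_elim (simp add: sum_distrib_left mult.assoc)
  then show ?thesis
    using F(1,2) L2_cmult[OF L2_span_L2[OF assms], of c]
    unfolding L2_span_def by (intro CollectI conjI exI[of _ F] exI[of _ "\<lambda>h. c * a h"])
qed

lemma L2_span_add:
  assumes "f \<in> L2_span S V" "g \<in> L2_span S V"
  shows "(\<lambda>x. f x + g x) \<in> L2_span S V"
proof -
  obtain F a where F: "finite F" "F \<subseteq> V" "AE x in lebesgue_on S. f x = (\<Sum>h\<in>F. a h * h x)"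
    using assms(1) by (auto simp: L2_span_def)
  obtain G b where G: "finite G" "G \<subseteq> V" "AE x in lebesgue_on S. g x = (\<Sum>h\<in>G. b h * h x)"
    using assms(2) by (auto simp: L2_span_def)
  let ?c = "\<lambda>h. (if h \<in> F then a h else 0) + (if h \<in> G then b h else 0)"
  have F': "(\<Sum>h\<in>F \<union> G. (if h \<in> F then a h else 0) * h x) = (\<Sum>h\<in>F. a h * h x)" for x
    using F(1) G(1) by (intro sum.mono_neutral_cong_right) auto
  have G': "(\<Sum>h\<in>F \<union> G. (if h \<in> G then b h else 0) * h x) = (\<Sum>h\<in>G. b h * h x)" for x
    using F(1) G(1) by (intro sum.mono_neutral_cong_right) auto
  have "AE x in lebesgue_on S. f x + g x = (\<Sum>h\<in>F \<union> G. ?c h * h x)"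
    using F(3) G(3) by eventually_elim (simp only: distrib_right sum.distrib F' G')
  moreover have "(\<lambda>x. f x + g x) \<in> L2 S"
    using assms by (intro L2_add L2_span_L2)
  ultimately show ?thesis
    using F(1,2) G(1,2) unfolding L2_span_def
    by (intro CollectI conjI exI[of _ "F \<union> G"] exI[of _ ?c]) auto
qed

lemma L2_span_diff:
  assumes "f \<in> L2_span S V" "g \<in> L2_span S V"
  shows "(\<lambda>x. f x - g x) \<in> L2_span S V"
  using L2_span_add[OF assms(1) L2_span_cmult[OF assms(2), of "-1"]] by simp

lemma L2_span_combination:
  assumes "S \<in> sets lebesgue" "\<And>i. i \<in> A \<Longrightarrow> f i \<in> L2_span S V"
  shows "(\<lambda>x. \<Sum>i\<in>A. c i * f i x) \<in> L2_span S V"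
proof -
  have zero: "(\<lambda>x. 0) \<in> L2_span S V"
    unfolding L2_span_def using L2_zero[OF assms(1)]
    by (intro CollectI conjI exI[of _ "{}"]) auto
  show ?thesis using assms(2)
    by (induction A rule: infinite_finite_induct) (auto simp: zero intro!: L2_span_add L2_span_cmult)
qed

text \<open>
  In a span, the coefficients belong to functions, so an indexed family with repeated members
  would count a member once. Choosing one index for each function that occurs, and the coefficient
  zero for the other indices, recovers a combination over the index set.
\<close>
lemma L2_span_image:
  assumes "finite A" "g \<in> L2_span S (f ` A)"
  obtains c where "AE x in lebesgue_on S. g x = (\<Sum>i\<in>A. c i * f i x)"
proof -
  obtain F a where F: "F \<subseteq> f ` A" "AE x in lebesgue_on S. g x = (\<Sum>h\<in>F. a h * h x)"
    using assms(2) by (auto simp: L2_span_def)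
  obtain B where B: "B \<subseteq> A" "inj_on f B" "F = f ` B"
    using F(1) by (auto simp: subset_image_inj)
  let ?c = "\<lambda>i. if i \<in> B then a (f i) else 0"
  have "(\<Sum>h\<in>F. a h * h x) = (\<Sum>i\<in>A. ?c i * f i x)" for x
  proof -
    have "(\<Sum>h\<in>F. a h * h x) = (\<Sum>i\<in>B. a (f i) * f i x)"
      using B(2,3) by (simp add: sum.reindex)
    also have "\<dots> = (\<Sum>i\<in>A. ?c i * f i x)"
      using assms(1) B(1) by (intro sum.mono_neutral_cong_left) auto
    finally show ?thesis .
  qed
  then show thesis using F(2) that[of ?c] by simp
qed

section \<open>Orthonormal families\<close>

definition orthonormal_on :: "'a::euclidean_space set \<Rightarrow> 'i set \<Rightarrow> ('i \<Rightarrow> 'a \<Rightarrow> real) \<Rightarrow> bool" where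
  "orthonormal_on S A \<kappa> \<longleftrightarrow> (\<forall>l\<in>A. \<kappa> l \<in> L2 S) \<and>
     (\<forall>i\<in>A. \<forall>j\<in>A. l2_inner S (\<kappa> i) (\<kappa> j) = (if i = j then 1 else 0))"

text \<open>
  The formula defines the orthogonal projection only for an orthonormal family. Its value
  is a pointwise defined function, so that it can also be restricted to subsets of \<open>S\<close>.
\<close>
definition l2_proj ::
  "'a::euclidean_space set \<Rightarrow> 'i set \<Rightarrow> ('i \<Rightarrow> 'a \<Rightarrow> real) \<Rightarrow> ('a \<Rightarrow> real) \<Rightarrow> 'a \<Rightarrow> real" where
  "l2_proj S A \<kappa> v = (\<lambda>x. \<Sum>l\<in>A. l2_inner S v (\<kappa> l) * \<kappa> l x)"

lemma orthonormal_on_subset: "orthonormal_on S A \<kappa> \<Longrightarrow> B \<subseteq> A \<Longrightarrow> orthonormal_on S B \<kappa>"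
  unfolding orthonormal_on_def by blast

lemma l2_proj_L2: "S \<in> sets lebesgue \<Longrightarrow> orthonormal_on S A \<kappa> \<Longrightarrow> l2_proj S A \<kappa> v \<in> L2 S"
  unfolding l2_proj_def by (intro L2_combination) (auto simp: orthonormal_on_def)

lemma orthonormal_combination_inner:
  assumes "finite A" "orthonormal_on S A \<kappa>" "l \<in> A"
  shows "l2_inner S (\<lambda>x. \<Sum>i\<in>A. c i * \<kappa> i x) (\<kappa> l) = c l"
proof -
  have "l2_inner S (\<lambda>x. \<Sum>i\<in>A. c i * \<kappa> i x) (\<kappa> l) = (\<Sum>i\<in>A. c i * l2_inner S (\<kappa> i) (\<kappa> l))"
    using assms by (intro l2_inner_combination_left) (auto simp: orthonormal_on_def)
  also have "\<dots> = (\<Sum>i\<in>A. if i = l then c i else 0)"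
    using assms by (intro sum.cong) (auto simp: orthonormal_on_def)
  finally show ?thesis using assms by simp
qed

lemma orthonormal_combination_norm:
  assumes "S \<in> sets lebesgue" "finite A" "orthonormal_on S A \<kappa>"
  shows "l2_inner S (\<lambda>x. \<Sum>i\<in>A. c i * \<kappa> i x) (\<lambda>x. \<Sum>i\<in>A. c i * \<kappa> i x) = (\<Sum>i\<in>A. (c i)\<^sup>2)"
proof -
  let ?g = "\<lambda>x. \<Sum>i\<in>A. c i * \<kappa> i x"
  have "l2_inner S ?g ?g = (\<Sum>i\<in>A. c i * l2_inner S ?g (\<kappa> i))"
    using assms by (intro l2_inner_combination_right L2_combination) (auto simp: orthonormal_on_def)
  then show ?thesis
    using orthonormal_combination_inner[OF assms(2,3)] by (simp add: power2_eq_square)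
qed

lemma l2_proj_residual_orthogonal:
  assumes "finite A" "orthonormal_on S A \<kappa>" "v \<in> L2 S" "l \<in> A"
  shows "l2_inner S (\<lambda>x. v x - l2_proj S A \<kappa> v x) (\<kappa> l) = 0"
proof -
  have "l2_inner S (l2_proj S A \<kappa> v) (\<kappa> l) = l2_inner S v (\<kappa> l)"
    unfolding l2_proj_def by (rule orthonormal_combination_inner[OF assms(1,2,4)])
  then show ?thesis
    using assms l2_proj_L2[OF L2_sets[OF assms(3)] assms(2)]
    by (subst l2_inner_diff_left) (auto simp: orthonormal_on_def)
qed

text \<open>
  Pythagoras: the residual is orthogonal to the projection. Nonnegativity of the left-hand side
  is Bessel's inequality; vanishing of the left-hand side is Parseval's identity for \<open>v\<close>.
\<close>
lemma l2_proj_residual_norm: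
  assumes "finite A" "orthonormal_on S A \<kappa>" "v \<in> L2 S"
  shows "l2_inner S (\<lambda>x. v x - l2_proj S A \<kappa> v x) (\<lambda>x. v x - l2_proj S A \<kappa> v x)
    = l2_inner S v v - (\<Sum>l\<in>A. (l2_inner S v (\<kappa> l))\<^sup>2)"
proof -
  let ?p = "l2_proj S A \<kappa> v" and ?r = "\<lambda>x. v x - l2_proj S A \<kappa> v x"
  have p: "?p \<in> L2 S" by (rule l2_proj_L2[OF L2_sets[OF assms(3)] assms(2)])
  have r: "?r \<in> L2 S" by (rule L2_diff[OF assms(3) p])
  have "l2_inner S ?r ?p = (\<Sum>l\<in>A. l2_inner S v (\<kappa> l) * l2_inner S ?r (\<kappa> l))"
    unfolding l2_proj_def using assms r unfolding l2_proj_def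
    by (intro l2_inner_combination_right) (auto simp: orthonormal_on_def)
  then have rp: "l2_inner S ?r ?p = 0"
    using l2_proj_residual_orthogonal[OF assms] by simp
  have pv: "l2_inner S ?p v = (\<Sum>l\<in>A. (l2_inner S v (\<kappa> l))\<^sup>2)"
    unfolding l2_proj_def using assms
    by (subst l2_inner_combination_left)
      (auto simp: orthonormal_on_def power2_eq_square l2_inner_commute[of S _ v])
  have "l2_inner S ?r ?r = l2_inner S ?r v - l2_inner S ?r ?p"
    by (rule l2_inner_diff_right[OF assms(3) p r])
  also have "l2_inner S ?r v = l2_inner S v v - l2_inner S ?p v"
    by (rule l2_inner_diff_left[OF assms(3) p assms(3)])
  finally show ?thesis using rp pv by simp
qed

lemma l2_Bessel:
  assumes "finite A" "orthonormal_on S A \<kappa>" "v \<in> L2 S"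
  shows "(\<Sum>l\<in>A. (l2_inner S v (\<kappa> l))\<^sup>2) \<le> l2_inner S v v"
  using l2_proj_residual_norm[OF assms] l2_inner_self_nonneg[of S "\<lambda>x. v x - l2_proj S A \<kappa> v x"]
  by linarith

section \<open>A positive eigenvalue of a symmetric matrix\<close>

text \<open>
  This is the first-order condition at a maximum: for small \<open>t\<close> of the sign of \<open>b\<close> the linear term
  would dominate.
\<close>
lemma quadratic_nonpos_imp_linear_coeff_0:
  fixes b c :: real
  assumes "\<And>t. 2 * t * b + t\<^sup>2 * c \<le> 0"
  shows "b = 0"
proof (rule ccontr)
  assume "b \<noteq> 0"
  \<comment> \<open>With this step the quadratic term is smaller in size than half of the linear one.\<close>
  define t where "t = b / (\<bar>c\<bar> + 1)"
  have pos: "\<bar>c\<bar> + 1 > 0" by simp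
  have tb: "t * (\<bar>c\<bar> + 1) = b" using pos by (simp add: t_def)
  have "t \<noteq> 0" using \<open>b \<noteq> 0\<close> tb by auto
  have "2 * t * b + t\<^sup>2 * c = t\<^sup>2 * (2 * (\<bar>c\<bar> + 1) + c)"
    by (subst tb[symmetric]) (simp add: power2_eq_square algebra_simps)
  moreover have "t\<^sup>2 * (2 * (\<bar>c\<bar> + 1) + c) > 0"
    using \<open>t \<noteq> 0\<close> by (intro mult_pos_pos) auto
  ultimately show False using assms[of t] by linarith
qed

text \<open>
  Rayleigh's principle. The quadratic form of \<open>G\<close> attains its maximum \<open>c\<close> on the unit sphere,
  which is compact in the product topology once the coordinates outside \<open>X\<close> are set to zero; a
  maximiser is an eigenvector with eigenvalue \<open>c\<close>, by differentiation along the coordinate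
  directions. A positive diagonal entry is the value of the form at a coordinate vector, hence
  \<open>c > 0\<close>.
\<close>
lemma symmetric_matrix_positive_eigenvalue:
  fixes G :: "'i \<Rightarrow> 'i \<Rightarrow> real"
  assumes X: "finite X" and sym: "\<And>i j. i \<in> X \<Longrightarrow> j \<in> X \<Longrightarrow> G i j = G j i"
    and m: "m \<in> X" "0 < G m m"
  obtains a c where "0 < c" "(\<Sum>i\<in>X. (a i)\<^sup>2) = 1" "\<And>i. i \<in> X \<Longrightarrow> (\<Sum>j\<in>X. G i j * a j) = c * a i"
proof -
  define q where "q a = (\<Sum>i\<in>X. \<Sum>j\<in>X. G i j * a i * a j)" for a :: "'i \<Rightarrow> real"
  define n where "n a = (\<Sum>i\<in>X. (a i)\<^sup>2)" for a :: "'i \<Rightarrow> real"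
  define B where "B = (\<Pi>\<^sub>E i\<in>UNIV. if i \<in> X then {-1..1::real} else {0})"
  define K where "K = B \<inter> {a. n a = 1}"
  have contn: "continuous_on UNIV n"
    unfolding n_def by (intro continuous_intros continuous_on_product_coordinates)
  have contq: "continuous_on UNIV q"
    unfolding q_def by (intro continuous_intros continuous_on_product_coordinates)
  have "compactin (product_topology (\<lambda>i. euclidean) UNIV) B"
    unfolding B_def by (subst compactin_PiE) (auto simp: compactin_euclidean_iff)
  then have "compact B"
    by (simp add: euclidean_product_topology compactin_euclidean_iff)
  moreover have "closed {a. n a = 1}"
    using contn by (intro closed_Collect_eq) auto
  ultimately have K: "compact K"
    unfolding K_def by (rule compact_Int_closed)
  let ?e = "\<lambda>i. if i = m then 1 else 0 :: real"
  have em: "n ?e = 1" "q ?e = G m m"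
    using X m(1) by (auto simp: n_def q_def if_distrib[of "\<lambda>x. x\<^sup>2"] if_distrib[of "\<lambda>x. _ * x"] cong: if_cong)
  then have eK: "?e \<in> K" using m(1) by (auto simp: K_def B_def)
  obtain a where a: "a \<in> K" "\<And>b. b \<in> K \<Longrightarrow> q b \<le> q a"
    using continuous_attains_sup[OF K, of q] eK continuous_on_subset[OF contq] by blast
  define c where "c = q a"
  have c: "0 < c" using a(2)[OF eK] em m(2) by (simp add: c_def)
  have na: "n a = 1" using a(1) by (simp add: K_def)
  have qn: "q b \<le> c * n b" for b
  proof (cases "n b = 0")
    case True
    then have "b i = 0" if "i \<in> X" for i
      using X that by (simp add: n_def sum_nonneg_eq_0_iff)
    then have "q b = 0" by (simp add: q_def)
    then show ?thesis using True by simp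
  next
    case False
    have n0: "0 < n b"
      using False sum_nonneg[of X "\<lambda>i. (b i)\<^sup>2"] unfolding n_def by fastforce
    define s where "s = sqrt (n b)"
    have s: "0 < s" "s\<^sup>2 = n b" using n0 by (auto simp: s_def)
    \<comment> \<open>Both forms are homogeneous of degree two, so normalising \<open>b\<close> reduces to the unit sphere.\<close>
    let ?b = "\<lambda>i. if i \<in> X then b i / s else 0"
    have nb: "n ?b = 1"
      using s n0 by (simp add: n_def power_divide flip: sum_divide_distrib)
    have qb: "q ?b = q b / n b"
      unfolding s(2)[symmetric] by (simp add: q_def sum_divide_distrib power2_eq_square)
    have "b i / s \<in> {-1..1}" if i: "i \<in> X" for i
    proof -
      have "(?b i)\<^sup>2 \<le> n ?b" unfolding n_def using X i by (intro member_le_sum) auto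
      then have "(b i / s)\<^sup>2 \<le> 1\<^sup>2" using nb i by simp
      then show ?thesis by (subst (asm) abs_le_square_iff[symmetric]) (simp only: atLeastAtMost_iff, linarith)
    qed
    then have "?b \<in> B" by (auto simp: B_def)
    then have "q ?b \<le> c" using nb a(2) by (auto simp: K_def c_def)
    then show ?thesis using qb n0 by (simp add: field_simps)
  qed
  have "(\<Sum>j\<in>X. G i j * a j) = c * a i" if i: "i \<in> X" for i
  proof -
    let ?d = "\<lambda>j. if j = i then 1 else 0 :: real"
    have "2 * t * ((\<Sum>j\<in>X. G i j * a j) - c * a i) + t\<^sup>2 * (G i i - c) \<le> 0" for t
    proof -
      let ?at = "\<lambda>j. a j + t * ?d j"
      have "n ?at = n a + (2 * t * a i + t\<^sup>2)"
      proof -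
        have "n ?at = (\<Sum>j\<in>X. (a j)\<^sup>2 + (if j = i then 2 * t * a j + t\<^sup>2 else 0))"
          unfolding n_def by (intro sum.cong) (auto simp: power2_sum)
        then show ?thesis using X i by (simp add: sum.distrib n_def)
      qed
      moreover have "q ?at = q a + (2 * t * (\<Sum>j\<in>X. G i j * a j) + t\<^sup>2 * G i i)"
      proof -
        have "q ?at = (\<Sum>l\<in>X. \<Sum>j\<in>X. G l j * a l * a j + (if j = i then t * (G l j * a l) else 0)
             + (if l = i then t * (G l j * a j) + (if j = i then t\<^sup>2 * G l j else 0) else 0))"
          unfolding q_def by (intro sum.cong) (auto simp: algebra_simps power2_eq_square)
        also have "\<dots> = (\<Sum>l\<in>X. (\<Sum>j\<in>X. G l j * a l * a j) + t * (G l i * a l)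
            + (if l = i then t * (\<Sum>j\<in>X. G i j * a j) + t\<^sup>2 * G i i else 0))"
          using X i by (intro sum.cong) (simp_all add: sum.distrib sum_distrib_left)
        also have "\<dots> = q a + t * (\<Sum>l\<in>X. G l i * a l) + (t * (\<Sum>j\<in>X. G i j * a j) + t\<^sup>2 * G i i)"
          using X i by (simp add: sum.distrib q_def sum_distrib_left)
        also have "(\<Sum>l\<in>X. G l i * a l) = (\<Sum>j\<in>X. G i j * a j)"
          using sym i by (intro sum.cong) auto
        finally show ?thesis by simp
      qed
      ultimately show ?thesis
        using qn[of ?at] na by (simp add: c_def algebra_simps)
    qed
    then show ?thesis using quadratic_nonpos_imp_linear_coeff_0 by fastforce
  qed
  then show thesis using that c na by (simp add: n_def)
qed

section \<open>Completeness and truncation error of the POD basis\<close>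

lemma pod_op_inner:
  assumes "\<And>\<mu>. \<mu> \<in> \<Xi> \<Longrightarrow> u \<mu> \<in> L2 S" "w \<in> L2 S"
  shows "l2_inner S (pod_op S \<Xi> u v) w
    = (\<Sum>\<mu>\<in>\<Xi>. l2_inner S v (u \<mu>) * l2_inner S (u \<mu>) w) / real (card \<Xi>)"
  unfolding pod_op_def l2_inner_cmult_left using assms
  by (simp add: l2_inner_combination_left)

lemma pod_op_L2_span:
  assumes "\<And>\<mu>. \<mu> \<in> \<Xi> \<Longrightarrow> u \<mu> \<in> L2 S" "S \<in> sets lebesgue" "\<Xi> \<subseteq> D"
  shows "pod_op S \<Xi> u v \<in> L2_span S (u ` D)"
  unfolding pod_op_def using assms
  by (intro L2_span_cmult L2_span_combination L2_span_base) auto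

lemma pod_op_self_adjoint:
  assumes "\<And>\<mu>. \<mu> \<in> \<Xi> \<Longrightarrow> u \<mu> \<in> L2 S" "v \<in> L2 S" "w \<in> L2 S"
  shows "l2_inner S (pod_op S \<Xi> u v) w = l2_inner S v (pod_op S \<Xi> u w)"
  using pod_op_inner[of \<Xi> u S w v] pod_op_inner[of \<Xi> u S v w] assms
  by (simp add: l2_inner_commute[of S v "pod_op S \<Xi> u w"] l2_inner_commute[of S "u _"] mult.commute)

context
  fixes S :: "real set" and \<Xi> :: "'m set" and u :: "'m \<Rightarrow> real \<Rightarrow> real"
    and d :: nat and ev :: "nat \<Rightarrow> real" and \<kappa> :: "nat \<Rightarrow> real \<Rightarrow> real"
  assumes S: "S \<in> sets lebesgue" and \<Xi>: "finite \<Xi>" "\<Xi> \<noteq> {}"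
    and u: "\<And>\<mu>. \<mu> \<in> \<Xi> \<Longrightarrow> u \<mu> \<in> L2 S" and pod: "is_pod S \<Xi> u d ev \<kappa>"
begin

lemma pod_orthonormal: "orthonormal_on S {1..d} \<kappa>"
  using pod unfolding is_pod_def orthonormal_on_def by blast

lemma pod_eigenvalue_pos: "l \<in> {1..d} \<Longrightarrow> 0 < ev l"
  using pod by (auto simp: is_pod_def)

lemma pod_mode_L2: "l \<in> {1..d} \<Longrightarrow> \<kappa> l \<in> L2 S"
  using pod_orthonormal by (simp add: orthonormal_on_def)

lemma pod_op_L2: "pod_op S \<Xi> u v \<in> L2 S"
  using L2_span_L2[OF pod_op_L2_span[of \<Xi> u S \<Xi>]] u S by blast

lemma pod_eigen: "l \<in> {1..d} \<Longrightarrow> AE y in lebesgue_on S. pod_op S \<Xi> u (\<kappa> l) y = ev l * \<kappa> l y"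
  using pod by (simp add: is_pod_def)

lemma pod_eigen_inner:
  assumes "l \<in> {1..d}" "w \<in> L2 S"
  shows "l2_inner S (pod_op S \<Xi> u (\<kappa> l)) w = ev l * l2_inner S (\<kappa> l) w"
proof -
  have "l2_inner S (pod_op S \<Xi> u (\<kappa> l)) w = l2_inner S (\<lambda>y. ev l * \<kappa> l y) w"
    using assms pod_eigen[OF assms(1)] by (intro l2_inner_cong_AE pod_op_L2 L2_cmult pod_mode_L2)
  then show ?thesis by (simp add: l2_inner_cmult_left)
qed

text \<open>
  Dividing the eigenvalue equation by the positive eigenvalue writes the mode as a combination of
  snapshots. Hence the POD projection does not lead out of the span of the solution manifold,
  the space over which the Lebesgue constant is taken.
\<close>
lemma pod_mode_in_span:
  assumes l: "l \<in> {1..d}" and D: "\<Xi> \<subseteq> D"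
  shows "\<kappa> l \<in> L2_span S (u ` D)"
proof (rule L2_span_cong_AE)
  show "(\<lambda>y. (1 / ev l) * pod_op S \<Xi> u (\<kappa> l) y) \<in> L2_span S (u ` D)"
    using u S D by (intro L2_span_cmult pod_op_L2_span)
  show "\<kappa> l \<in> L2 S" by (rule pod_mode_L2[OF l])
  show "AE x in lebesgue_on S. \<kappa> l x = (1 / ev l) * pod_op S \<Xi> u (\<kappa> l) x"
    using pod_eigen[OF l] by eventually_elim (use pod_eigenvalue_pos[OF l] in simp)
qed

text \<open>
  Pairing the eigenvalue equation with the mode itself identifies the eigenvalue as the mean
  square of the coefficients of the snapshots along that mode.
\<close>
lemma pod_eigenvalue_energy:
  assumes "l \<in> {1..d}"
  shows "(\<Sum>\<mu>\<in>\<Xi>. (l2_inner S (u \<mu>) (\<kappa> l))\<^sup>2) / real (card \<Xi>) = ev l"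
proof -
  have "l2_inner S (\<kappa> l) (\<kappa> l) = 1"
    using pod_orthonormal assms by (simp add: orthonormal_on_def)
  then have "ev l = l2_inner S (pod_op S \<Xi> u (\<kappa> l)) (\<kappa> l)"
    using pod_eigen_inner[OF assms pod_mode_L2[OF assms]] by simp
  also have "\<dots> = (\<Sum>\<mu>\<in>\<Xi>. (l2_inner S (u \<mu>) (\<kappa> l))\<^sup>2) / real (card \<Xi>)"
    using pod_op_inner[of \<Xi> u S "\<kappa> l" "\<kappa> l"] u pod_mode_L2[OF assms]
    by (simp add: l2_inner_commute[of S "\<kappa> l"] power2_eq_square)
  finally show ?thesis by simp
qed

text \<open>
  Parseval's identity for the snapshots, i.e. the modes span them. Suppose that some residual
  \<open>r \<nu>\<close> of a snapshot after projection onto all modes is nonzero. Then the Gram matrix of the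
  residuals has a positive eigenvalue, and the corresponding combination \<open>v\<close> of residuals is an
  eigenfunction of the POD operator with nonzero eigenvalue that is orthogonal to all modes. But
  the modes contain a basis of every such eigenspace, so \<open>v\<close> would vanish, whereas its squared norm
  is the eigenvalue of the Gram matrix.
\<close>
lemma pod_complete:
  assumes \<mu>: "\<mu> \<in> \<Xi>"
  shows "l2_inner S (u \<mu>) (u \<mu>) = (\<Sum>l=1..d. (l2_inner S (u \<mu>) (\<kappa> l))\<^sup>2)"
proof (rule ccontr)
  assume neq: "l2_inner S (u \<mu>) (u \<mu>) \<noteq> (\<Sum>l=1..d. (l2_inner S (u \<mu>) (\<kappa> l))\<^sup>2)"
  define p where "p \<nu> = l2_proj S {1..d} \<kappa> (u \<nu>)" for \<nu>
  define r where "r \<nu> = (\<lambda>x. u \<nu> x - p \<nu> x)" for \<nu>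
  have p: "p \<nu> \<in> L2 S" for \<nu>
    unfolding p_def by (rule l2_proj_L2[OF S pod_orthonormal])
  have r: "r \<nu> \<in> L2 S" if "\<nu> \<in> \<Xi>" for \<nu>
    unfolding r_def using u that p by (intro L2_diff)
  have r_orth: "l2_inner S (r \<nu>) (\<kappa> l) = 0" if "\<nu> \<in> \<Xi>" "l \<in> {1..d}" for \<nu> l
    unfolding r_def p_def using u that pod_orthonormal
    by (intro l2_proj_residual_orthogonal) auto
  have "l2_inner S (r \<mu>) (r \<mu>) \<noteq> 0"
    using neq l2_proj_residual_norm[OF _ pod_orthonormal u[OF \<mu>]] by (simp add: r_def p_def)
  then have pos: "0 < l2_inner S (r \<mu>) (r \<mu>)"
    using l2_inner_self_nonneg[of S "r \<mu>"] by linarith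
  obtain a c where c: "0 < c" and a: "(\<Sum>\<nu>\<in>\<Xi>. (a \<nu>)\<^sup>2) = 1"
    and eig: "\<And>\<nu>. \<nu> \<in> \<Xi> \<Longrightarrow> (\<Sum>\<eta>\<in>\<Xi>. l2_inner S (r \<nu>) (r \<eta>) * a \<eta>) = c * a \<nu>"
  proof (rule symmetric_matrix_positive_eigenvalue
      [where G = "\<lambda>\<nu> \<eta>. l2_inner S (r \<nu>) (r \<eta>)", OF \<Xi>(1) l2_inner_commute \<mu> pos])
    fix a c
    assume "0 < c" "(\<Sum>\<nu>\<in>\<Xi>. (a \<nu>)\<^sup>2) = 1"
      "\<And>\<nu>. \<nu> \<in> \<Xi> \<Longrightarrow> (\<Sum>\<eta>\<in>\<Xi>. l2_inner S (r \<nu>) (r \<eta>) * a \<eta>) = c * a \<nu>"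
    then show thesis by (rule that)
  qed
  define v where "v = (\<lambda>x. \<Sum>\<eta>\<in>\<Xi>. a \<eta> * r \<eta> x)"
  have v: "v \<in> L2 S" unfolding v_def using r S by (intro L2_combination)
  have v_orth: "l2_inner S v (\<kappa> l) = 0" if "l \<in> {1..d}" for l
    unfolding v_def using that r r_orth pod_mode_L2 by (simp add: l2_inner_combination_left)
  have vr: "l2_inner S v (r \<nu>) = c * a \<nu>" if "\<nu> \<in> \<Xi>" for \<nu>
    using eig[OF that] l2_inner_combination_right[of \<Xi> r S "r \<nu>" a] r that
    unfolding v_def by (subst l2_inner_commute) (simp add: mult.commute)
  \<comment> \<open>On \<open>v\<close>, snapshots and residuals act alike, since their difference is a combination of modes.\<close>
  have vu: "l2_inner S v (u \<nu>) = c * a \<nu>" if "\<nu> \<in> \<Xi>" for \<nu>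
  proof -
    have "l2_inner S v (p \<nu>) = 0"
      unfolding p_def l2_proj_def using v v_orth pod_mode_L2
      by (subst l2_inner_combination_right) auto
    then show ?thesis
      using vr[OF that] l2_inner_diff_right[OF u[OF that] p v, of \<nu>] by (simp add: r_def)
  qed
  \<comment> \<open>Up to the factor \<open>c\<close> this sum is \<open>card \<Xi>\<close> times the coefficient of the image of \<open>v\<close> along \<open>\<kappa> l\<close>,
    which is zero because the operator is self-adjoint.\<close>
  have au_orth: "(\<Sum>\<nu>\<in>\<Xi>. a \<nu> * l2_inner S (u \<nu>) (\<kappa> l)) = 0" if l: "l \<in> {1..d}" for l
  proof -
    have "l2_inner S (pod_op S \<Xi> u v) (\<kappa> l) = l2_inner S (pod_op S \<Xi> u (\<kappa> l)) v"
      using pod_op_self_adjoint[of \<Xi> u S v "\<kappa> l"] u v pod_mode_L2[OF l]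
      by (simp add: l2_inner_commute)
    also have "\<dots> = 0"
      using pod_eigen_inner[OF l v] v_orth[OF l] by (simp add: l2_inner_commute)
    finally have "(\<Sum>\<nu>\<in>\<Xi>. l2_inner S v (u \<nu>) * l2_inner S (u \<nu>) (\<kappa> l)) / real (card \<Xi>) = 0"
      using pod_op_inner[of \<Xi> u S "\<kappa> l" v] u pod_mode_L2[OF l] by simp
    then have "c * (\<Sum>\<nu>\<in>\<Xi>. a \<nu> * l2_inner S (u \<nu>) (\<kappa> l)) = 0"
      using \<Xi> vu by (simp add: sum_distrib_left mult.assoc)
    then show ?thesis using c by simp
  qed
  \<comment> \<open>By the previous step the same combination of snapshots instead of residuals is again \<open>v\<close>.\<close>
  have "pod_op S \<Xi> u v y = c / real (card \<Xi>) * v y" for y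
  proof -
    have "(\<Sum>\<nu>\<in>\<Xi>. a \<nu> * p \<nu> y) = (\<Sum>l=1..d. (\<Sum>\<nu>\<in>\<Xi>. a \<nu> * l2_inner S (u \<nu>) (\<kappa> l)) * \<kappa> l y)"
      unfolding p_def l2_proj_def sum_distrib_left sum_distrib_right
      by (subst sum.swap) (simp add: mult.assoc)
    also have "\<dots> = 0" using au_orth by simp
    finally have "v y = (\<Sum>\<nu>\<in>\<Xi>. a \<nu> * u \<nu> y)"
      by (simp add: v_def r_def right_diff_distrib sum_subtractf)
    then show ?thesis
      using vu by (simp add: pod_op_def sum_distrib_left mult.assoc)
  qed
  then have "v \<in> L2_span S (\<kappa> ` {l \<in> {1..d}. ev l = c / real (card \<Xi>)})"
    using pod v c \<Xi> unfolding is_pod_def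
    by (elim conjE allE[of _ "c / real (card \<Xi>)"] allE[of _ v]) (auto elim!: mp)
  then obtain b where b: "AE x in lebesgue_on S.
      v x = (\<Sum>l | l \<in> {1..d} \<and> ev l = c / real (card \<Xi>). b l * \<kappa> l x)" (is "AE x in _. v x = ?w x")
    by (rule L2_span_image[rotated]) auto
  have "l2_inner S v v = l2_inner S ?w v"
    using b v S pod_mode_L2 by (intro l2_inner_cong_AE L2_combination) auto
  also have "\<dots> = 0"
    using v v_orth pod_mode_L2
    by (subst l2_inner_combination_left) (auto simp: l2_inner_commute[of S _ v])
  finally have "l2_inner S v v = 0" .
  moreover have "l2_inner S v v = (\<Sum>\<nu>\<in>\<Xi>. a \<nu> * l2_inner S v (r \<nu>))"
    using l2_inner_combination_right[of \<Xi> r S v a] r v by (simp add: v_def)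
  moreover have "\<dots> = c * (\<Sum>\<nu>\<in>\<Xi>. (a \<nu>)\<^sup>2)"
    using vr by (simp add: sum_distrib_left power2_eq_square mult.left_commute)
  ultimately show False using a c by simp
qed

text \<open>
  By Parseval, the squared residual of a snapshot is the sum of its squared coefficients beyond \<open>k\<close>;
  averaging over the training set turns each of them into an eigenvalue.
\<close>
lemma pod_truncation_error:
  assumes "k \<le> d"
  shows "(\<Sum>\<mu>\<in>\<Xi>. l2_inner S (\<lambda>x. u \<mu> x - l2_proj S {1..k} \<kappa> (u \<mu>) x)
                          (\<lambda>x. u \<mu> x - l2_proj S {1..k} \<kappa> (u \<mu>) x)) / real (card \<Xi>)
    = (\<Sum>l=k+1..d. ev l)"
proof -
  have on: "orthonormal_on S {1..k} \<kappa>"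
    using assms by (intro orthonormal_on_subset[OF pod_orthonormal]) auto
  have split: "{1..d} = {1..k} \<union> {k+1..d}" "{1..k} \<inter> {k+1..d} = {}"
    using assms by auto
  have "l2_inner S (\<lambda>x. u \<mu> x - l2_proj S {1..k} \<kappa> (u \<mu>) x) (\<lambda>x. u \<mu> x - l2_proj S {1..k} \<kappa> (u \<mu>) x)
      = (\<Sum>l=k+1..d. (l2_inner S (u \<mu>) (\<kappa> l))\<^sup>2)" if "\<mu> \<in> \<Xi>" for \<mu>
    using l2_proj_residual_norm[OF _ on u[OF that]] pod_complete[OF that]
    unfolding split(1) by (subst (asm) sum.union_disjoint) (use split(2) in auto)
  then have "(\<Sum>\<mu>\<in>\<Xi>. l2_inner S (\<lambda>x. u \<mu> x - l2_proj S {1..k} \<kappa> (u \<mu>) x)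
                          (\<lambda>x. u \<mu> x - l2_proj S {1..k} \<kappa> (u \<mu>) x)) / real (card \<Xi>)
      = (\<Sum>\<mu>\<in>\<Xi>. \<Sum>l=k+1..d. (l2_inner S (u \<mu>) (\<kappa> l))\<^sup>2) / real (card \<Xi>)"
    by simp
  also have "\<dots> = (\<Sum>l=k+1..d. (\<Sum>\<mu>\<in>\<Xi>. (l2_inner S (u \<mu>) (\<kappa> l))\<^sup>2) / real (card \<Xi>))"
    by (subst sum.swap) (simp add: sum_divide_distrib)
  also have "\<dots> = (\<Sum>l=k+1..d. ev l)"
    by (intro sum.cong pod_eigenvalue_energy) auto
  finally show ?thesis .
qed

end

section \<open>Partitions produced by bisection\<close>

lemma Union_bisect: "\<Union> (bisect I) = I"
  by (auto simp: bisect_def Let_def)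

lemma disjoint_bisect: "disjoint (bisect I)"
  by (auto simp: bisect_def Let_def disjoint_def)

lemma finite_bisect: "finite (bisect I)"
  by (simp add: bisect_def Let_def)

lemma bisect_measurable: "I \<in> sets lebesgue \<Longrightarrow> bisect I \<subseteq> sets lebesgue"
  by (auto simp: bisect_def Let_def)

text \<open>
  Every new cell lies in a unique cell of the old partition. Two new cells with different
  parents are separated by the parents, two with the same parent are its two halves.
\<close>
lemma disjoint_bisect_refinement:
  assumes "disjoint Q" "M \<subseteq> Q"
  shows "disjoint ((Q - M) \<union> \<Union> (bisect ` M))"
proof (unfold disjoint_def, intro ballI impI)
  fix A B assume A: "A \<in> (Q - M) \<union> \<Union> (bisect ` M)" and B: "B \<in> (Q - M) \<union> \<Union> (bisect ` M)"
    and neq: "A \<noteq> B"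
  have parent: "\<exists>I\<in>Q. C \<subseteq> I \<and> (C = I \<and> I \<notin> M \<or> I \<in> M \<and> C \<in> bisect I)"
    if C: "C \<in> (Q - M) \<union> \<Union> (bisect ` M)" for C
  proof (cases "C \<in> Q - M")
    case False
    then obtain I where "I \<in> M" "C \<in> bisect I" using C by blast
    then show ?thesis using Union_bisect[of I] assms(2) by blast
  qed blast
  obtain I where I: "I \<in> Q" "A \<subseteq> I" "A = I \<and> I \<notin> M \<or> I \<in> M \<and> A \<in> bisect I"
    using parent[OF A] by blast
  obtain J where J: "J \<in> Q" "B \<subseteq> J" "B = J \<and> J \<notin> M \<or> J \<in> M \<and> B \<in> bisect J"
    using parent[OF B] by blast
  show "A \<inter> B = {}"
  proof (cases "I = J")
    case True
    then have "A \<in> bisect I" "B \<in> bisect I" using I(3) J(3) neq by auto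
    then show ?thesis using neq by (rule disjointD[OF disjoint_bisect])
  next
    case False
    then have "I \<inter> J = {}" by (rule disjointD[OF assms(1) I(1) J(1)])
    then show ?thesis using I(2) J(2) by blast
  qed
qed

lemma adaptive_run_partition:
  assumes run: "adaptive_run \<omega> e tol Tmax P T" and "\<omega> \<in> sets lebesgue" and "t \<le> T"
  shows "finite (P t) \<and> disjoint (P t) \<and> \<Union> (P t) = \<omega> \<and> P t \<subseteq> sets lebesgue"
  using assms(3)
proof (induction t)
  case 0
  then show ?case using assms by (simp add: adaptive_run_def disjoint_def)
next
  case (Suc t)
  then have IH: "finite (P t)" "disjoint (P t)" "\<Union> (P t) = \<omega>" "P t \<subseteq> sets lebesgue"
    by auto
  define M where "M = {I \<in> P t. e (P t) I > measure lebesgue I / measure lebesgue \<omega> * tol}"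
  have "t < T" using Suc.prems by simp
  then have M: "M \<subseteq> P t" "P (Suc t) = (P t - M) \<union> \<Union> (bisect ` M)"
    using run unfolding adaptive_run_def Let_def M_def by blast+
  have "finite M" using M(1) IH(1) by (rule finite_subset)
  then have "finite (P (Suc t))" using IH(1) M(2) by (simp add: finite_bisect)
  moreover have "disjoint (P (Suc t))"
    unfolding M(2) by (rule disjoint_bisect_refinement[OF IH(2) M(1)])
  moreover have "\<Union> (P (Suc t)) = \<omega>"
  proof -
    have "\<Union> (\<Union> (bisect ` M)) = \<Union> M"
    proof -
      have "\<Union> (\<Union> (bisect ` M)) = (\<Union>I\<in>M. \<Union> (bisect I))" by blast
      then show ?thesis by (simp add: Union_bisect)
    qed
    then have "\<Union> (P (Suc t)) = \<Union> (P t - M) \<union> \<Union> M" unfolding M(2) by (simp only: Union_Un_distrib)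
    also have "\<dots> = \<omega>" using M(1) IH(3) by blast
    finally show ?thesis .
  qed
  moreover have "P (Suc t) \<subseteq> sets lebesgue"
    unfolding M(2) using bisect_measurable M(1) IH(4) by blast
  ultimately show ?case by blast
qed

section \<open>Functionals and interpolation on one cell\<close>

text \<open>
  Bounded linear functionals in Riesz form. The equation is required for arbitrary functions, as the
  functionals of a dictionary are defined on all of them.
\<close>
definition l2_functional :: "'a::euclidean_space set \<Rightarrow> (('a \<Rightarrow> real) \<Rightarrow> real) \<Rightarrow> bool" where
  "l2_functional S \<tau> \<longleftrightarrow> (\<exists>\<rho>\<in>L2 S. \<forall>v. \<tau> v = l2_inner S v \<rho>)"

lemma local_dictionary_l2_functional:
  assumes "is_dictionary \<omega> R" "I \<subseteq> \<omega>" "I \<in> sets lebesgue" "\<tau> \<in> local_dictionary R I"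
  shows "l2_functional I \<tau>"
proof -
  obtain \<rho> where "\<rho> \<in> R" "\<tau> = (\<lambda>v. l2_inner I v \<rho>)"
    using assms(4) by (auto simp: local_dictionary_def)
  moreover have "\<rho> \<in> L2 I"
    using L2_mono[OF _ assms(2,3)] assms(1) \<open>\<rho> \<in> R\<close> by (auto simp: is_dictionary_def)
  ultimately show ?thesis unfolding l2_functional_def by blast
qed

lemma l2_functional_add:
  "l2_functional S \<tau> \<Longrightarrow> f \<in> L2 S \<Longrightarrow> g \<in> L2 S \<Longrightarrow> \<tau> (\<lambda>x. f x + g x) = \<tau> f + \<tau> g"
  by (auto simp: l2_functional_def l2_inner_add_left)

lemma l2_functional_combination:
  "l2_functional S \<tau> \<Longrightarrow> (\<And>i. i \<in> A \<Longrightarrow> f i \<in> L2 S) \<Longrightarrow>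
    \<tau> (\<lambda>x. \<Sum>i\<in>A. c i * f i x) = (\<Sum>i\<in>A. c i * \<tau> (f i))"
  by (auto simp: l2_functional_def l2_inner_combination_left)

lemma l2_functional_cong_AE:
  "l2_functional S \<tau> \<Longrightarrow> f \<in> L2 S \<Longrightarrow> g \<in> L2 S \<Longrightarrow> AE x in lebesgue_on S. f x = g x \<Longrightarrow> \<tau> f = \<tau> g"
  unfolding l2_functional_def by (elim bexE) (simp only:, rule l2_inner_cong_AE)

lemma l2_functional_bounded:
  assumes "l2_functional S \<tau>"
  obtains C where "0 \<le> C" "\<And>v. v \<in> L2 S \<Longrightarrow> \<bar>\<tau> v\<bar> \<le> C * l2_norm S v"
proof -
  obtain \<rho> where \<rho>: "\<rho> \<in> L2 S" "\<And>v. \<tau> v = l2_inner S v \<rho>"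
    using assms by (auto simp: l2_functional_def)
  then have "\<bar>\<tau> v\<bar> \<le> l2_norm S \<rho> * l2_norm S v" if "v \<in> L2 S" for v
    using l2_Cauchy_Schwarz[OF that \<rho>(1)] by (simp add: mult.commute)
  then show thesis using that l2_norm_nonneg by blast
qed

text \<open>
  This is the dimension count behind the reproduction property of interpolation: as many functionals
  as basis functions give a square matrix, for which a one-sided inverse is two-sided.
\<close>
lemma right_inverse_imp_left_inverse:
  fixes A B :: "nat \<Rightarrow> nat \<Rightarrow> 'a::field"
  assumes "\<And>i j. i \<in> {1..N} \<Longrightarrow> j \<in> {1..N} \<Longrightarrow> (\<Sum>l=1..N. A i l * B l j) = (if i = j then 1 else 0)"
    and "i \<in> {1..N}" "j \<in> {1..N}"
  shows "(\<Sum>l=1..N. B i l * A l j) = (if i = j then 1 else 0)"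
proof -
  define mA mB where "mA = mat N N (\<lambda>(i, j). A (Suc i) (Suc j))"
    and "mB = mat N N (\<lambda>(i, j). B (Suc i) (Suc j))"
  have carrier: "mA \<in> carrier_mat N N" "mB \<in> carrier_mat N N" by (auto simp: mA_def mB_def)
  have sum_eq: "(\<Sum>l=1..N. f l) = (\<Sum>l=0..<N. f (Suc l))" for f :: "nat \<Rightarrow> 'a"
    by (simp add: sum.atLeast1_atMost_eq atLeast0LessThan)
  have "mA * mB = 1\<^sub>m N"
  proof (rule eq_matI)
    fix i j assume "i < dim_row (1\<^sub>m N :: 'a mat)" "j < dim_col (1\<^sub>m N :: 'a mat)"
    then have ij: "i < N" "j < N" by auto
    have "(mA * mB) $$ (i, j) = (\<Sum>l=0..<N. A (Suc i) (Suc l) * B (Suc l) (Suc j))"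
      using ij by (simp add: mA_def mB_def scalar_prod_def)
    also have "\<dots> = (\<Sum>l=1..N. A (Suc i) l * B l (Suc j))"
      by (rule sum_eq[symmetric])
    also have "\<dots> = 1\<^sub>m N $$ (i, j)"
      using ij by (subst assms(1)) auto
    finally show "(mA * mB) $$ (i, j) = 1\<^sub>m N $$ (i, j)" .
  qed (auto simp: mA_def mB_def)
  then have BA: "mB * mA = 1\<^sub>m N"
    by (rule mat_mult_left_right_inverse[OF carrier])
  obtain i' j' where ij: "i = Suc i'" "j = Suc j'" "i' < N" "j' < N"
    using assms(2,3) by (cases i; cases j) auto
  have "(\<Sum>l=1..N. B i l * A l j) = (\<Sum>l=0..<N. B i (Suc l) * A (Suc l) j)"
    by (rule sum_eq)
  also have "\<dots> = (mB * mA) $$ (i', j')"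
    using ij by (simp add: mA_def mB_def scalar_prod_def)
  finally show ?thesis using ij unfolding BA by simp
qed

text \<open>
  A nodal basis taken from the span of \<open>N\<close> functions is a basis of that span, so interpolation
  reproduces the span. In coordinates, let \<open>B\<close> expand the nodal functions in terms of the \<open>b l\<close>.
  Duality says that \<open>B\<close> is inverse on one side to the matrix of the values \<open>\<sigma> i (b l)\<close>, and the claim
  for \<open>g = b m\<close> is that it is inverse on the other side.
\<close>
lemma nodal_interpolation_exact:
  fixes N :: nat
  assumes I: "I \<in> sets lebesgue" and b: "\<And>l. l \<in> {1..N} \<Longrightarrow> b l \<in> L2 I"
    and \<sigma>: "\<And>j. j \<in> {1..N} \<Longrightarrow> l2_functional I (\<sigma> j)"
    and \<theta>: "\<And>j. j \<in> {1..N} \<Longrightarrow> \<theta> j \<in> L2_span I (b ` {1..N})"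
    and nodal: "\<And>i j. i \<in> {1..N} \<Longrightarrow> j \<in> {1..N} \<Longrightarrow> \<sigma> i (\<theta> j) = (if i = j then 1 else 0)"
    and g: "g \<in> L2_span I (b ` {1..N})"
  shows "AE x in lebesgue_on I. g x = (\<Sum>j=1..N. \<sigma> j g * \<theta> j x)"
proof -
  have "\<forall>j\<in>{1..N}. \<exists>c. AE x in lebesgue_on I. \<theta> j x = (\<Sum>l=1..N. c l * b l x)"
  proof
    fix j assume j: "j \<in> {1..N}"
    show "\<exists>c. AE x in lebesgue_on I. \<theta> j x = (\<Sum>l=1..N. c l * b l x)"
      using L2_span_image[OF finite_atLeastAtMost \<theta>[OF j]] by blast
  qed
  from bchoice[OF this] obtain B where B: "\<And>j. j \<in> {1..N} \<Longrightarrow> AE x in lebesgue_on I. \<theta> j x = (\<Sum>l=1..N. B j l * b l x)"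
    by blast
  obtain c where c: "AE x in lebesgue_on I. g x = (\<Sum>l=1..N. c l * b l x)"
    by (rule L2_span_image[OF finite_atLeastAtMost g])
  have \<sigma>_expand: "\<sigma> i h = (\<Sum>l=1..N. a l * \<sigma> i (b l))"
    if "i \<in> {1..N}" "h \<in> L2 I" "AE x in lebesgue_on I. h x = (\<Sum>l=1..N. a l * b l x)" for i h a
  proof -
    have "\<sigma> i h = \<sigma> i (\<lambda>x. \<Sum>l=1..N. a l * b l x)"
      by (rule l2_functional_cong_AE[OF \<sigma>[OF that(1)] that(2) _ that(3)])
        (rule L2_combination[OF I b])
    also have "\<dots> = (\<Sum>l=1..N. a l * \<sigma> i (b l))"
      by (rule l2_functional_combination[OF \<sigma>[OF that(1)] b])
    finally show ?thesis .
  qed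
  have "(\<Sum>l=1..N. \<sigma> i (b l) * B j l) = (if i = j then 1 else 0)"
    if "i \<in> {1..N}" "j \<in> {1..N}" for i j
    using \<sigma>_expand[OF that(1) L2_span_L2[OF \<theta>[OF that(2)]] B[OF that(2)]] nodal[OF that]
    by (simp add: mult.commute)
  then have inv: "(\<Sum>j=1..N. B j l * \<sigma> j (b m)) = (if l = m then 1 else 0)"
    if "l \<in> {1..N}" "m \<in> {1..N}" for l m
    using right_inverse_imp_left_inverse[of N "\<lambda>i l. \<sigma> i (b l)" "\<lambda>l j. B j l"] that by simp
  have coeff: "(\<Sum>j=1..N. \<sigma> j g * B j l) = c l" if l: "l \<in> {1..N}" for l
  proof -
    have "(\<Sum>j=1..N. \<sigma> j g * B j l) = (\<Sum>j=1..N. \<Sum>m=1..N. c m * (B j l * \<sigma> j (b m)))"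
      using \<sigma>_expand[OF _ L2_span_L2[OF g] c]
      by (intro sum.cong) (simp_all add: sum_distrib_left mult_ac)
    also have "\<dots> = (\<Sum>m=1..N. c m * (\<Sum>j=1..N. B j l * \<sigma> j (b m)))"
      by (subst sum.swap) (simp add: sum_distrib_left)
    also have "\<dots> = (\<Sum>m=1..N. if l = m then c m else 0)"
      using inv[OF l] by (intro sum.cong) auto
    finally show ?thesis using l by simp
  qed
  have "AE x in lebesgue_on I. \<forall>j\<in>{1..N}. \<theta> j x = (\<Sum>l=1..N. B j l * b l x)"
    using B by (intro eventually_ball_finite) auto
  with c show ?thesis
  proof eventually_elim
    case (elim x)
    have "(\<Sum>j=1..N. \<sigma> j g * \<theta> j x) = (\<Sum>j=1..N. \<Sum>l=1..N. \<sigma> j g * B j l * b l x)"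
      using elim(2) by (intro sum.cong) (simp_all add: sum_distrib_left mult.assoc)
    also have "\<dots> = (\<Sum>l=1..N. (\<Sum>j=1..N. \<sigma> j g * B j l) * b l x)"
      by (subst sum.swap) (simp add: sum_distrib_right)
    also have "\<dots> = g x" using coeff elim(1) by simp
    finally show ?case by simp
  qed
qed

lemma local_interp_L2:
  assumes "I \<subseteq> S" "I \<in> sets lebesgue" "S \<in> sets lebesgue" "\<And>j. j \<in> {1..N} \<Longrightarrow> \<theta> j \<in> L2 I"
  shows "local_interp I N \<sigma> \<theta> v \<in> L2 S"
  unfolding local_interp_def using assms by (intro L2_extend_by_zero L2_combination)

lemma local_interp_bounded:
  assumes I: "I \<in> sets lebesgue" and \<sigma>: "\<And>j. j \<in> {1..N} \<Longrightarrow> l2_functional I (\<sigma> j)"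
    and \<theta>: "\<And>j. j \<in> {1..N} \<Longrightarrow> \<theta> j \<in> L2 I"
  obtains C where "0 \<le> C" "\<And>v. v \<in> L2 I \<Longrightarrow> l2_norm I (local_interp I N \<sigma> \<theta> v) \<le> C * l2_norm I v"
proof -
  have "\<exists>K. \<forall>j\<in>{1..N}. 0 \<le> K j \<and> (\<forall>v\<in>L2 I. \<bar>\<sigma> j v\<bar> \<le> K j * l2_norm I v)"
    using l2_functional_bounded[OF \<sigma>] by (intro bchoice ballI) metis
  then obtain K where K: "\<And>j. j \<in> {1..N} \<Longrightarrow> 0 \<le> K j"
    "\<And>j v. j \<in> {1..N} \<Longrightarrow> v \<in> L2 I \<Longrightarrow> \<bar>\<sigma> j v\<bar> \<le> K j * l2_norm I v"
    by blast
  show thesis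
  proof (rule that[of "\<Sum>j=1..N. K j * l2_norm I (\<theta> j)"])
    show "0 \<le> (\<Sum>j=1..N. K j * l2_norm I (\<theta> j))"
      using K(1) by (intro sum_nonneg mult_nonneg_nonneg l2_norm_nonneg)
    fix v assume v: "v \<in> L2 I"
    have "l2_norm I (local_interp I N \<sigma> \<theta> v) = l2_norm I (\<lambda>x. \<Sum>j=1..N. \<sigma> j v * \<theta> j x)"
      unfolding l2_norm_def by (subst l2_inner_cong[OF I]) (auto simp: local_interp_def)
    also have "\<dots> \<le> (\<Sum>j=1..N. \<bar>\<sigma> j v\<bar> * l2_norm I (\<theta> j))"
      using I \<theta> by (rule l2_norm_combination)
    also have "\<dots> \<le> (\<Sum>j=1..N. K j * l2_norm I v * l2_norm I (\<theta> j))"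
      using K(2)[OF _ v] by (intro sum_mono mult_right_mono l2_norm_nonneg)
    also have "\<dots> = (\<Sum>j=1..N. K j * l2_norm I (\<theta> j)) * l2_norm I v"
      by (simp add: sum_distrib_left mult_ac)
    finally show "l2_norm I (local_interp I N \<sigma> \<theta> v) \<le> (\<Sum>j=1..N. K j * l2_norm I (\<theta> j)) * l2_norm I v" .
  qed
qed

text \<open>
  A real supremum bounds its members only if they are bounded above, which follows from the
  operator bound. That bound also covers a function that vanishes on \<open>I\<close>, for which the quotient
  carries no information: its interpolant has norm zero.
\<close>
lemma local_interp_le_lebesgue_const:
  assumes I: "I \<in> sets lebesgue" "I \<subseteq> \<omega>" and \<sigma>: "\<And>j. j \<in> {1..N} \<Longrightarrow> l2_functional I (\<sigma> j)"
    and \<theta>: "\<And>j. j \<in> {1..N} \<Longrightarrow> \<theta> j \<in> L2 I" and w: "w \<in> L2_span \<omega> M"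
  shows "l2_norm I (local_interp I N \<sigma> \<theta> w)
    \<le> lebesgue_const \<omega> M I (local_interp I N \<sigma> \<theta>) * l2_norm I w"
proof -
  let ?J = "local_interp I N \<sigma> \<theta>"
  obtain C where C: "0 \<le> C" "\<And>v. v \<in> L2 I \<Longrightarrow> l2_norm I (?J v) \<le> C * l2_norm I v"
    using local_interp_bounded[of I N \<sigma> \<theta>, OF I(1) \<sigma> \<theta>] by blast
  have L2I: "g \<in> L2 I" if "g \<in> L2_span \<omega> M" for g
    using L2_mono[OF L2_span_L2[OF that] I(2,1)] .
  show ?thesis
  proof (cases "l2_norm I w = 0")
    case True
    then show ?thesis using C(2)[OF L2I[OF w]] by simp
  next
    case False
    then have pos: "0 < l2_norm I w" using l2_norm_nonneg[of I w] by linarith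
    have "l2_norm I (?J g) / l2_norm I g \<le> C" if "g \<in> L2_span \<omega> M" for g
      using C(1) C(2)[OF L2I[OF that]] l2_norm_nonneg[of I g]
      by (cases "l2_norm I g = 0") (auto simp: divide_le_eq)
    then have "bdd_above ((\<lambda>g. l2_norm I (?J g) / l2_norm I g) ` L2_span \<omega> M)"
      by (intro bdd_aboveI[of _ C]) auto
    then have "l2_norm I (?J w) / l2_norm I w \<le> lebesgue_const \<omega> M I ?J"
      unfolding lebesgue_const_def using w by (rule cSUP_upper[rotated])
    then show ?thesis using pos by (simp add: divide_le_eq)
  qed
qed

section \<open>Interpolation on the whole partition and the error estimate\<close>

lemma epm_interp_on_cell:
  assumes "finite P" "disjoint P" "I \<in> P" "x \<in> I"
  shows "epm_interp P N \<sigma> \<theta> v x = (\<Sum>j=1..N I. \<sigma> I j v * \<theta> I j x)"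
proof -
  have "epm_interp P N \<sigma> \<theta> v x
      = (\<Sum>J\<in>P. if J = I then \<Sum>j=1..N I. \<sigma> I j v * \<theta> I j x else 0)"
    unfolding epm_interp_def
  proof (intro sum.cong refl)
    fix J assume "J \<in> P"
    then have "x \<notin> J" if "J \<noteq> I"
      using that disjointD[OF assms(2), of I J] assms(3,4) by auto
    then show "local_interp J (N J) (\<sigma> J) (\<theta> J) v x
        = (if J = I then \<Sum>j=1..N I. \<sigma> I j v * \<theta> I j x else 0)"
      using assms(4) by (auto simp: local_interp_def)
  qed
  then show ?thesis using assms(1,3) by simp
qed

lemma AE_lebesgue_on_Union:
  assumes "finite P" "P \<subseteq> sets lebesgue" "\<And>I. I \<in> P \<Longrightarrow> AE x in lebesgue_on I. Q x"
  shows "AE x in lebesgue_on (\<Union>P). Q x"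
proof -
  have "AE x in lebesgue. x \<in> I \<longrightarrow> Q x" if "I \<in> P" for I
    using assms(3)[OF that] assms(2) that by (subst (asm) AE_restrict_space_iff) auto
  then have "AE x in lebesgue. \<forall>I\<in>P. x \<in> I \<longrightarrow> Q x"
    using assms(1) by (intro eventually_ball_finite) auto
  then have "AE x in lebesgue. x \<in> \<Union>P \<longrightarrow> Q x"
    by eventually_elim auto
  moreover have "\<Union>P \<in> sets lebesgue"
    using assms(1,2) by (intro sets.finite_Union)
  ultimately show ?thesis by (simp add: AE_restrict_space_iff)
qed

text \<open>
  The central estimate. Here \<open>w\<close> is the part of a snapshot left by the POD projection, \<open>z\<close> its
  interpolant and \<open>e\<close> the interpolation error. As \<open>w\<close> is orthogonal to the modes, \<open>e\<close> and \<open>- z\<close> have the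
  same coefficients, and Bessel's inequality bounds the projection of \<open>e\<close> by the norm of \<open>z\<close>, which
  splits over the cells and is controlled on each of them by the stability constant.
\<close>
lemma projected_error_le:
  assumes P: "finite P" "disjoint P" "\<Union>P = \<omega>" "P \<subseteq> sets lebesgue"
    and on: "finite A" "orthonormal_on \<omega> A \<kappa>"
    and L2: "e \<in> L2 \<omega>" "w \<in> L2 \<omega>" "z \<in> L2 \<omega>"
    and e: "AE x in lebesgue_on \<omega>. e x = w x - z x"
    and orth: "\<And>l. l \<in> A \<Longrightarrow> l2_inner \<omega> w (\<kappa> l) = 0"
    and stab: "\<And>I. I \<in> P \<Longrightarrow> l2_norm I z \<le> \<Lambda> I * l2_norm I w"
  shows "(\<Sum>I\<in>P. (l2_norm I (l2_proj \<omega> A \<kappa> e))\<^sup>2) \<le> (\<Sum>I\<in>P. (\<Lambda> I)\<^sup>2) * l2_inner \<omega> w w"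
proof -
  have \<omega>: "\<omega> \<in> sets lebesgue" using L2 by (simp add: L2_sets)
  have coeff: "l2_inner \<omega> e (\<kappa> l) = - l2_inner \<omega> z (\<kappa> l)" if "l \<in> A" for l
  proof -
    have \<kappa>: "\<kappa> l \<in> L2 \<omega>" using on(2) that by (simp add: orthonormal_on_def)
    have "l2_inner \<omega> e (\<kappa> l) = l2_inner \<omega> (\<lambda>x. w x - z x) (\<kappa> l)"
      using L2 \<kappa> e by (intro l2_inner_cong_AE L2_diff)
    then show ?thesis using orth[OF that] L2 \<kappa> by (simp add: l2_inner_diff_left)
  qed
  have "(\<Sum>I\<in>P. (l2_norm I (l2_proj \<omega> A \<kappa> e))\<^sup>2) = l2_inner \<omega> (l2_proj \<omega> A \<kappa> e) (l2_proj \<omega> A \<kappa> e)"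
    using l2_inner_partition[OF _ _ P] l2_proj_L2[OF \<omega> on(2)] by (simp add: l2_norm_power2)
  also have "\<dots> = (\<Sum>l\<in>A. (l2_inner \<omega> e (\<kappa> l))\<^sup>2)"
    unfolding l2_proj_def by (rule orthonormal_combination_norm[OF \<omega> on])
  also have "\<dots> = (\<Sum>l\<in>A. (l2_inner \<omega> z (\<kappa> l))\<^sup>2)"
    using coeff by simp
  also have "\<dots> \<le> l2_inner \<omega> z z"
    by (rule l2_Bessel[OF on L2(3)])
  also have "\<dots> = (\<Sum>I\<in>P. (l2_norm I z)\<^sup>2)"
    using l2_inner_partition[OF L2(3) L2(3) P] by (simp add: l2_norm_power2)
  also have "\<dots> \<le> (\<Sum>I\<in>P. (\<Lambda> I)\<^sup>2 * l2_inner \<omega> w w)"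
  proof (rule sum_mono)
    fix I assume I: "I \<in> P"
    have "(l2_norm I z)\<^sup>2 \<le> (\<Lambda> I * l2_norm I w)\<^sup>2"
      using stab[OF I] by (intro power_mono l2_norm_nonneg)
    also have "\<dots> = (\<Lambda> I)\<^sup>2 * l2_inner I w w"
      by (simp add: power_mult_distrib l2_norm_power2)
    also have "\<dots> \<le> (\<Lambda> I)\<^sup>2 * l2_inner \<omega> w w"
      using L2(2) I P by (intro mult_left_mono l2_inner_self_mono) auto
    finally show "(l2_norm I z)\<^sup>2 \<le> (\<Lambda> I)\<^sup>2 * l2_inner \<omega> w w" .
  qed
  finally show ?thesis by (simp add: sum_distrib_right)
qed

text \<open>
  Interpolation is linear and reproduces the POD space on every cell, so replacing a snapshot by its
  POD residual does not change the interpolation error. The residual is a member of the span of the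
  solution manifold, though in general not of the manifold itself.
\<close>
lemma projected_interpolation_error_le:
  assumes P: "finite P" "disjoint P" "\<Union>P = \<omega>" "P \<subseteq> sets lebesgue"
    and on: "finite A" "orthonormal_on \<omega> A \<kappa>" and \<kappa>: "\<And>l. l \<in> A \<Longrightarrow> \<kappa> l \<in> L2_span \<omega> M"
    and b: "\<And>I l. I \<in> P \<Longrightarrow> l \<in> {1..N I} \<Longrightarrow> b I l \<in> L2 I"
    and span: "\<And>I. I \<in> P \<Longrightarrow> L2_span I (b I ` {1..N I}) = L2_span I (\<kappa> ` A)"
    and \<sigma>: "\<And>I j. I \<in> P \<Longrightarrow> j \<in> {1..N I} \<Longrightarrow> l2_functional I (\<sigma> I j)"
    and \<theta>: "\<And>I j. I \<in> P \<Longrightarrow> j \<in> {1..N I} \<Longrightarrow> \<theta> I j \<in> L2_span I (b I ` {1..N I})"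
    and nodal: "\<And>I i j. I \<in> P \<Longrightarrow> i \<in> {1..N I} \<Longrightarrow> j \<in> {1..N I} \<Longrightarrow>
      \<sigma> I i (\<theta> I j) = (if i = j then 1 else 0)"
    and v: "v \<in> L2_span \<omega> M"
  shows "(\<Sum>I\<in>P. (l2_norm I (l2_proj \<omega> A \<kappa> (\<lambda>x. v x - epm_interp P N \<sigma> \<theta> v x)))\<^sup>2)
    \<le> (\<Sum>I\<in>P. (lebesgue_const \<omega> M I (local_interp I (N I) (\<sigma> I) (\<theta> I)))\<^sup>2)
      * l2_inner \<omega> (\<lambda>x. v x - l2_proj \<omega> A \<kappa> v x) (\<lambda>x. v x - l2_proj \<omega> A \<kappa> v x)"
proof -
  let ?J = "epm_interp P N \<sigma> \<theta>"
  define p where "p = l2_proj \<omega> A \<kappa> v"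
  define w where "w = (\<lambda>x. v x - p x)"
  have vL2: "v \<in> L2 \<omega>" using v by (rule L2_span_L2)
  have \<omega>: "\<omega> \<in> sets lebesgue" using vL2 by (rule L2_sets)
  have cell: "I \<in> sets lebesgue" "I \<subseteq> \<omega>" if "I \<in> P" for I
    using P that by auto
  have \<theta>L2: "\<theta> I j \<in> L2 I" if "I \<in> P" "j \<in> {1..N I}" for I j
    using \<theta>[OF that] by (rule L2_span_L2)
  have JL2: "?J g \<in> L2 \<omega>" for g
    unfolding epm_interp_def using cell \<theta>L2 \<omega> by (intro L2_sum local_interp_L2)
  have p: "p \<in> L2_span \<omega> M"
    unfolding p_def l2_proj_def using \<omega> \<kappa> by (rule L2_span_combination)
  have w: "w \<in> L2_span \<omega> M" unfolding w_def using v p by (rule L2_span_diff)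
  have pL2: "p \<in> L2 \<omega>" and wL2: "w \<in> L2 \<omega>" using p w by (auto intro: L2_span_L2)
  have J_cell: "?J g x = (\<Sum>j=1..N I. \<sigma> I j g * \<theta> I j x)" if "I \<in> P" "x \<in> I" for I g x
    by (rule epm_interp_on_cell[OF P(1,2) that])
  have "AE x in lebesgue_on I. v x - ?J v x = w x - ?J w x" if I: "I \<in> P" for I
  proof -
    have "p \<in> L2_span I (b I ` {1..N I})"
      unfolding span[OF I] p_def l2_proj_def using on(2) cell[OF I]
      by (intro L2_span_combination L2_span_base) (auto simp: orthonormal_on_def intro: L2_mono)
    then have exact: "AE x in lebesgue_on I. p x = (\<Sum>j=1..N I. \<sigma> I j p * \<theta> I j x)"
      using cell[OF I] b[OF I] \<sigma>[OF I] \<theta>[OF I] nodal[OF I]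
      by (intro nodal_interpolation_exact)
    have \<sigma>_split: "\<sigma> I j v = \<sigma> I j w + \<sigma> I j p" if "j \<in> {1..N I}" for j
      using l2_functional_add[OF \<sigma>[OF I that] L2_mono[OF wL2 cell(2,1)[OF I]] L2_mono[OF pL2 cell(2,1)[OF I]]]
      by (simp add: w_def)
    have "AE x in lebesgue_on I. x \<in> I"
      using AE_space[of "lebesgue_on I"] by simp
    with exact show ?thesis
    proof eventually_elim
      case (elim x)
      have "?J v x = (\<Sum>j=1..N I. (\<sigma> I j w + \<sigma> I j p) * \<theta> I j x)"
        using \<sigma>_split by (simp add: J_cell[OF I elim(2)])
      also have "\<dots> = ?J w x + p x"
        by (simp only: J_cell[OF I elim(2)] elim(1) distrib_right sum.distrib)
      finally show ?case by (simp add: w_def)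
    qed
  qed
  then have diff: "AE x in lebesgue_on \<omega>. v x - ?J v x = w x - ?J w x"
    using AE_lebesgue_on_Union[OF P(1,4)] P(3) by blast
  have orth: "l2_inner \<omega> w (\<kappa> l) = 0" if "l \<in> A" for l
    unfolding w_def p_def by (rule l2_proj_residual_orthogonal[OF on vL2 that])
  have stab: "l2_norm I (?J w)
      \<le> lebesgue_const \<omega> M I (local_interp I (N I) (\<sigma> I) (\<theta> I)) * l2_norm I w" if I: "I \<in> P" for I
  proof -
    have "l2_norm I (?J w) = l2_norm I (local_interp I (N I) (\<sigma> I) (\<theta> I) w)"
      unfolding l2_norm_def
      by (subst l2_inner_cong[OF cell(1)[OF I]]) (auto simp: J_cell[OF I] local_interp_def)
    then show ?thesis
      using local_interp_le_lebesgue_const[OF cell[OF I] \<sigma>[OF I] \<theta>L2[OF I] w] by simp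
  qed
  show ?thesis
    using projected_error_le[OF P on L2_diff[OF vL2 JL2] wL2 JL2 diff orth stab]
    by (simp only: w_def p_def)
qed

theorem proposition2p3:
  fixes y0 y1 tol :: real and \<omega> :: "real set"
    and D \<Xi> :: "(real ^ 'p) set" and u :: "real ^ 'p \<Rightarrow> real \<Rightarrow> real"
    and d k Tmax T :: nat and ev :: "nat \<Rightarrow> real" and \<kappa> :: "nat \<Rightarrow> real \<Rightarrow> real"
    and R :: "(real \<Rightarrow> real) set"
    and N :: "real set \<Rightarrow> nat" and \<kappa>I q \<theta> :: "real set \<Rightarrow> nat \<Rightarrow> real \<Rightarrow> real"
    and \<sigma> :: "real set \<Rightarrow> nat \<Rightarrow> (real \<Rightarrow> real) \<Rightarrow> real"
    and P :: "nat \<Rightarrow> real set set"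
  assumes omega: "y0 < y1" "\<omega> = {y0<..<y1}"
    and u: "(\<lambda>(\<mu>, z). u \<mu> z) \<in> L2 (D \<times> \<omega>)" "\<And>\<mu>. \<mu> \<in> D \<Longrightarrow> u \<mu> \<in> L2 \<omega>"
    and training: "\<Xi> \<subseteq> D" "finite \<Xi>" "\<Xi> \<noteq> {}"
    and pod: "is_pod \<omega> \<Xi> u d ev \<kappa>" "k \<le> d"
    and dict: "is_dictionary \<omega> R"
    and unisolv: "\<And>t I. t \<le> T \<Longrightarrow> I \<in> P t \<Longrightarrow> unisolvent \<omega> (u ` D) I (local_dictionary R I)"
    and local_basis:
      "\<And>t I l. t \<le> T \<Longrightarrow> I \<in> P t \<Longrightarrow> l \<in> {1..N I} \<Longrightarrow> \<kappa>I I l \<in> L2 I"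
      "\<And>t I. t \<le> T \<Longrightarrow> I \<in> P t \<Longrightarrow> L2_independent I (N I) (\<kappa>I I)"
      "\<And>t I. t \<le> T \<Longrightarrow> I \<in> P t \<Longrightarrow>
         L2_span I (\<kappa>I I ` {1..N I}) = L2_span I (\<kappa> ` {1..k})"
    and root_basis: "N \<omega> = k" "\<And>l x. l \<in> {1..k} \<Longrightarrow> x \<in> \<omega> \<Longrightarrow> \<kappa>I \<omega> l x = \<kappa> l x"
    and geim: "\<And>t I. t \<le> T \<Longrightarrow> I \<in> P t \<Longrightarrow>
         is_geim (local_dictionary R I) I (N I) (\<kappa>I I) (\<sigma> I) (q I) (\<theta> I)"
    and run: "adaptive_run \<omega> (\<lambda>Q. local_err \<omega> \<Xi> u k \<kappa> (epm_interp Q N \<sigma> \<theta>)) tol Tmax P T"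
  shows "sqrt (\<Sum>I\<in>P T. local_err \<omega> \<Xi> u k \<kappa> (epm_interp (P T) N \<sigma> \<theta>) I)
    \<le> sqrt (real k)
      * (1 + sqrt (\<Sum>I\<in>P T.
               (lebesgue_const \<omega> (u ` D) I (local_interp I (N I) (\<sigma> I) (\<theta> I)))\<^sup>2))
      * sqrt (\<Sum>l=k+1..d. ev l)"
proof -
  define J where "J = epm_interp (P T) N \<sigma> \<theta>"
  define \<Lambda>2 where "\<Lambda>2 = (\<Sum>I\<in>P T. (lebesgue_const \<omega> (u ` D) I (local_interp I (N I) (\<sigma> I) (\<theta> I)))\<^sup>2)"
  define E where "E = (\<Sum>l=k+1..d. ev l)"
  define w where "w \<mu> = (\<lambda>x. u \<mu> x - l2_proj \<omega> {1..k} \<kappa> (u \<mu>) x)" for \<mu>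
  have \<omega>: "\<omega> \<in> sets lebesgue" by (simp add: omega(2))
  have P: "finite (P T)" "disjoint (P T)" "\<Union> (P T) = \<omega>" "P T \<subseteq> sets lebesgue"
    using adaptive_run_partition[OF run \<omega> order_refl] by auto
  have snapshots: "u \<mu> \<in> L2 \<omega>" if "\<mu> \<in> \<Xi>" for \<mu>
    using u(2) training(1) that by blast
  note pod_facts = \<omega> training(2,3) snapshots pod(1)
  have on: "orthonormal_on \<omega> {1..k} \<kappa>"
    by (rule orthonormal_on_subset[OF pod_orthonormal[OF pod_facts]]) (use pod(2) in auto)
  have modes: "\<kappa> l \<in> L2_span \<omega> (u ` D)" if "l \<in> {1..k}" for l
    by (rule pod_mode_in_span[OF pod_facts _ training(1)]) (use pod(2) that in auto)
  have functionals: "l2_functional I (\<sigma> I j)" if "I \<in> P T" "j \<in> {1..N I}" for I j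
  proof (rule local_dictionary_l2_functional[OF dict])
    show "\<sigma> I j \<in> local_dictionary R I"
      using geim[OF order_refl that(1)] that(2) unfolding is_geim_def by blast
  qed (use P that in auto)
  have nodal: "\<theta> I j \<in> L2_span I (\<kappa>I I ` {1..N I})"
    "i \<in> {1..N I} \<Longrightarrow> \<sigma> I i (\<theta> I j) = (if i = j then 1 else 0)"
    if "I \<in> P T" "j \<in> {1..N I}" for I i j
    using geim[OF order_refl that(1)] that(2) unfolding is_geim_def by blast+
  have err: "(\<Sum>I\<in>P T. (l2_norm I (l2_proj \<omega> {1..k} \<kappa> (\<lambda>x. u \<mu> x - J (u \<mu>) x)))\<^sup>2)
      \<le> \<Lambda>2 * l2_inner \<omega> (w \<mu>) (w \<mu>)" if "\<mu> \<in> \<Xi>" for \<mu>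
    unfolding J_def \<Lambda>2_def w_def
  proof (rule projected_interpolation_error_le[OF P finite_atLeastAtMost on modes
        local_basis(1)[OF order_refl] local_basis(3)[OF order_refl] functionals nodal])
    show "u \<mu> \<in> L2_span \<omega> (u ` D)"
      using that training(1) snapshots by (intro L2_span_base) auto
  qed
  have "(\<Sum>I\<in>P T. local_err \<omega> \<Xi> u k \<kappa> J I)
      = (\<Sum>\<mu>\<in>\<Xi>. \<Sum>I\<in>P T. (l2_norm I (l2_proj \<omega> {1..k} \<kappa> (\<lambda>x. u \<mu> x - J (u \<mu>) x)))\<^sup>2) / real (card \<Xi>)"
    unfolding local_err_def l2_proj_def by (subst sum.swap) (simp add: sum_divide_distrib)
  also have "\<dots> \<le> (\<Sum>\<mu>\<in>\<Xi>. \<Lambda>2 * l2_inner \<omega> (w \<mu>) (w \<mu>)) / real (card \<Xi>)"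
    using err by (intro divide_right_mono sum_mono) auto
  also have "\<dots> = \<Lambda>2 * ((\<Sum>\<mu>\<in>\<Xi>. l2_inner \<omega> (w \<mu>) (w \<mu>)) / real (card \<Xi>))"
    by (simp add: sum_distrib_left)
  also have "(\<Sum>\<mu>\<in>\<Xi>. l2_inner \<omega> (w \<mu>) (w \<mu>)) / real (card \<Xi>) = E"
    unfolding w_def E_def by (rule pod_truncation_error[OF pod_facts pod(2)])
  finally have bound: "(\<Sum>I\<in>P T. local_err \<omega> \<Xi> u k \<kappa> J I) \<le> \<Lambda>2 * E" .
  show ?thesis
  proof (cases "k = 0")
    case True
    then show ?thesis by (simp add: local_err_def l2_norm_def l2_inner_def)
  next
    case False
    have "0 \<le> ev l" if "l \<in> {k+1..d}" for l
      using pod_eigenvalue_pos[OF pod_facts, of l] that by simp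
    then have "0 \<le> E" unfolding E_def by (rule sum_nonneg)
    then have nonneg: "0 \<le> sqrt \<Lambda>2" "0 \<le> sqrt E"
      by (simp_all add: \<Lambda>2_def sum_nonneg)
    have "sqrt (\<Sum>I\<in>P T. local_err \<omega> \<Xi> u k \<kappa> J I) \<le> sqrt \<Lambda>2 * sqrt E"
      unfolding real_sqrt_mult[symmetric] using bound by (rule real_sqrt_le_mono)
    also have "\<dots> \<le> (sqrt (real k) * (1 + sqrt \<Lambda>2)) * sqrt E"
    proof (rule mult_right_mono[OF _ nonneg(2)])
      have "1 * sqrt \<Lambda>2 \<le> sqrt (real k) * (1 + sqrt \<Lambda>2)"
        using False nonneg by (intro mult_mono) auto
      then show "sqrt \<Lambda>2 \<le> sqrt (real k) * (1 + sqrt \<Lambda>2)" by simp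
    qed
    finally show ?thesis unfolding J_def \<Lambda>2_def E_def .
  qed
qed

end
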